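(* Let $n\ge 2$. The representation $\pi_n$ of $\mathcal{B}_n$ on $(\mathbb{C}^2)^{\otimes n}$ decomposes as $$(\mathbb{C}^2)^{\otimes n}\cong\begin{cases}(\mathbb{C}^2)^{\otimes (n+1)/2}\otimes V_1 & n\text{ odd},\\ (\mathbb{C}^2)^{\otimes n/2}\otimes (W_1\oplus W_2) & n\text{ even},\end{cases}$$ an isomorphism of representations of $\mathcal{B}_n$ in which $\mathcal{B}_n$ acts trivially on the first tensor factor on the right-hand side (so $V_1$, respectively each of $W_1$ and $W_2$, occurs with multiplicity $2^{(n+1)/2}$, respectively $2^{n/2}$).
   Context: $\mathcal{B}_n$ is Artin's braid group with generators $\sigma_1,\dots,\sigma_{n-1}$ and relations $\sigma_i\sigma_j=\sigma_j\sigma_i$ for $|i-j|\ge 2$ and $\sigma_i\sigma_{i+1}\sigma_i=\sigma_{i+1}\sigma_i\sigma_{i+1}$ for $1\le i\le n-2$. Let $I_m$ be the $m\times m$ identity matrix and $$R=\frac{1}{\sqrt2}\begin{pmatrix}1&0&0&1\\0&1&-1&0\\0&1&1&0\\-1&0&0&1\end{pmatrix},$$ which satisfies the Yang-Baxter equation. The representation $\pi_n$ of $\mathcal{B}_n$ on $(\mathbb{C}^2)^{\otimes n}$ is defined by $\pi_n(\sigma_i)=I_2^{\otimes (i-1)}\otimes R\otimes I_2^{\otimes (n-i-1)}$. Tensor products of matrices use the "left into right" convention: if $A=\begin{pmatrix}a&b\\c&d\end{pmatrix}$ then $X\otimes A=\begin{pmatrix}aX&bX\\ cX&dX\end{pmatrix}$.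 Put $s=\begin{pmatrix}0&1\\-1&0\end{pmatrix}$, $\sigma_z=\begin{pmatrix}1&0\\0&-1\end{pmatrix}$, $\zeta=\frac{1}{\sqrt2}(1+\sqrt{-1})$, $d=\mathrm{diag}(\zeta,\overline\zeta)$, $D=\mathrm{diag}(\zeta,\overline\zeta,\overline\zeta,\zeta)$ and $M=\frac{1}{\sqrt2}\begin{pmatrix}1&1\\-1&1\end{pmatrix}$. For $n=2k+1$ odd, $V_1$ is the irreducible $2^k$-dimensional representation $\hat\rho_1$ of $\mathcal{B}_n$ on $(\mathbb{C}^2)^{\otimes k}$ given by $\hat\rho_1(\sigma_1)=d\otimes I_2^{\otimes (k-1)}$; $\hat\rho_1(\sigma_{2i})=I_2^{\otimes (i-1)}\otimes M\otimes I_2^{\otimes (k-i)}$ for $1\le i\le k$; $\hat\rho_1(\sigma_{2i+1})=I_2^{\otimes (i-1)}\otimes D\otimes I_2^{\otimes (k-i-1)}$ for $1\le i\le k-1$. For $n=2k$ even, $W_1$ and $W_2$ are the two inequivalent irreducible $2^{k-1}$-dimensional representations $\hat\lambda_1,\hat\lambda_2$ of $\mathcal{B}_n$ on $(\mathbb{C}^2)^{\otimes (k-1)}$ given by $\hat\lambda_j(\sigma_i)=\frac{1}{\sqrt2}(\lambda_j(x_i)+I_{2^{k-1}})$ for $1\le i\le 2k-1$, where for $k\ge2$: $\lambda_1(x_1)=\lambda_2(x_1)=\sqrt{-1}\,\sigma_z\otimes I_2^{\otimes (k-2)}$; $\lambda_1(x_{2i})=\lambda_2(x_{2i})=I_2^{\otimes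 (i-1)}\otimes s\otimes I_2^{\otimes (k-i-1)}$ for $1\le i\le k-1$; $\lambda_1(x_{2i+1})=\lambda_2(x_{2i+1})=\sqrt{-1}\,I_2^{\otimes (i-1)}\otimes\sigma_z\otimes\sigma_z\otimes I_2^{\otimes (k-i-2)}$ for $1\le i\le k-2$; and $\lambda_1(x_{2k-1})=-\lambda_2(x_{2k-1})=\sqrt{-1}\,I_2^{\otimes (k-2)}\otimes\sigma_z$. For $k=1$, $\lambda_1(x_1)=-\lambda_2(x_1)=\sqrt{-1}$. (Equivalently, $W_1\oplus W_2$ is the restriction of the representation $\hat\rho_1$ of $\mathcal{B}_{2k+1}$ to $\mathcal{B}_{2k}=\langle\sigma_1,\dots,\sigma_{2k-1}\rangle$.) *)

theory Defs
  imports Complex_Main "HOL-Algebra.Group" "Jordan_Normal_Form.Matrix"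
begin

section \<open>Groups given by generators and relations\<close>

text \<open>A letter \<open>(s, True)\<close> stands for the generator \<open>s\<close>, and \<open>(s, False)\<close> for its
  formal inverse.\<close>

type_synonym 'a gword = "('a \<times> bool) list"

abbreviation gwords :: "'a set \<Rightarrow> 'a gword set" where
  "gwords S \<equiv> lists (S \<times> UNIV)"

text \<open>The least congruence on words in \<open>S\<close> and formal inverses that cancels inverse pairs of
  letters and identifies the two sides of every relation \<open>(l, r) \<in> R\<close>.\<close>

inductive_set pres_rel :: "'a set \<Rightarrow> ('a gword \<times> 'a gword) set \<Rightarrow> ('a gword \<times> 'a gword) set"
  for S R where
  rel_refl: "w \<in> gwords S \<Longrightarrow> (w, w) \<in> pres_rel S R"
| rel_sym: "(v, w) \<in> pres_rel S R \<Longrightarrow> (w, v) \<in> pres_rel S R"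
| rel_trans: "(u, v) \<in> pres_rel S R \<Longrightarrow> (v, w) \<in> pres_rel S R \<Longrightarrow> (u, w) \<in> pres_rel S R"
| rel_cancel: "u \<in> gwords S \<Longrightarrow> v \<in> gwords S \<Longrightarrow> s \<in> S \<Longrightarrow>
    (u @ [(s, b), (s, \<not> b)] @ v, u @ v) \<in> pres_rel S R"
| rel_relator: "u \<in> gwords S \<Longrightarrow> v \<in> gwords S \<Longrightarrow> (l, r) \<in> R \<Longrightarrow> l \<in> gwords S \<Longrightarrow> r \<in> gwords S \<Longrightarrow>
    (u @ l @ v, u @ r @ v) \<in> pres_rel S R"

definition presented_group ::
    "'a set \<Rightarrow> ('a gword \<times> 'a gword) set \<Rightarrow> 'a gword set monoid" where
  "presented_group S R =
    \<lparr> carrier = gwords S // pres_rel S R,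
      mult = (\<lambda>A B. \<Union>a\<in>A. \<Union>b\<in>B. pres_rel S R `` {a @ b}),
      one = pres_rel S R `` {[]} \<rparr>"

definition pres_gen :: "'a set \<Rightarrow> ('a gword \<times> 'a gword) set \<Rightarrow> 'a \<Rightarrow> 'a gword set" where
  "pres_gen S R s = pres_rel S R `` {[(s, True)]}"

primrec word_eval :: "('g, 'm) monoid_scheme \<Rightarrow> ('a \<Rightarrow> 'g) \<Rightarrow> 'a gword \<Rightarrow> 'g" where
  "word_eval G f [] = \<one>\<^bsub>G\<^esub>"
| "word_eval G f (x # w) =
    (if snd x then f (fst x) else inv\<^bsub>G\<^esub> f (fst x)) \<otimes>\<^bsub>G\<^esub> word_eval G f w"

text \<open>The map on classes of words sending each generator \<open>s\<close> to \<open>f s\<close>. It is meaningful when \<open>f\<close>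
  respects the relations; see \<open>pres_lift_hom\<close> and \<open>pres_lift_gen\<close> below.\<close>

definition pres_lift :: "('g, 'm) monoid_scheme \<Rightarrow> ('a \<Rightarrow> 'g) \<Rightarrow> 'a gword set \<Rightarrow> 'g" where
  "pres_lift G f A = the_elem (word_eval G f ` A)"

lemma pres_rel_gwords: "(v, w) \<in> pres_rel S R \<Longrightarrow> v \<in> gwords S \<and> w \<in> gwords S"
  by (induction rule: pres_rel.induct) simp_all

lemma equiv_pres_rel: "equiv (gwords S) (pres_rel S R)"
proof (rule equivI)
  show "pres_rel S R \<subseteq> gwords S \<times> gwords S"
    by (rule subrelI, drule pres_rel_gwords) simp
  show "refl_on (gwords S) (pres_rel S R)"
    by (rule refl_onI) (rule pres_rel.rel_refl)
  show "sym (pres_rel S R)"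
    by (rule symI) (rule pres_rel.rel_sym)
  show "trans (pres_rel S R)"
    by (rule transI) (rule pres_rel.rel_trans)
qed

lemma pres_rel_append_left:
  assumes "(v, w) \<in> pres_rel S R" "u \<in> gwords S"
  shows "(u @ v, u @ w) \<in> pres_rel S R"
  using assms
proof (induction rule: pres_rel.induct)
  case (rel_refl w)
  then show ?case by (intro pres_rel.rel_refl) simp
next
  case (rel_cancel u' v s b)
  then show ?case using pres_rel.rel_cancel[of "u @ u'" S v s b R] by simp
next
  case (rel_relator u' v l r)
  then show ?case using pres_rel.rel_relator[of "u @ u'" S v l r R] by simp
next
  case (rel_sym v w)
  then show ?case by (metis pres_rel.rel_sym)
next
  case (rel_trans v w x)
  then show ?case by (metis pres_rel.rel_trans)
qed

lemma pres_rel_append_right: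
  assumes "(v, w) \<in> pres_rel S R" "u \<in> gwords S"
  shows "(v @ u, w @ u) \<in> pres_rel S R"
  using assms
proof (induction rule: pres_rel.induct)
  case (rel_refl w)
  then show ?case by (intro pres_rel.rel_refl) simp
next
  case (rel_cancel u' v s b)
  then show ?case using pres_rel.rel_cancel[of u' S "v @ u" s b R] by simp
next
  case (rel_relator u' v l r)
  then show ?case using pres_rel.rel_relator[of u' S "v @ u" l r R] by simp
next
  case (rel_sym v w)
  then show ?case by (metis pres_rel.rel_sym)
next
  case (rel_trans v w x)
  then show ?case by (metis pres_rel.rel_trans)
qed

lemma pres_rel_append:
  assumes "(u, u') \<in> pres_rel S R" "(v, v') \<in> pres_rel S R"
  shows "(u @ v, u' @ v') \<in> pres_rel S R"
proof (rule pres_rel.rel_trans)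
  show "(u @ v, u' @ v) \<in> pres_rel S R"
    using assms pres_rel_gwords[OF assms(2)] by (intro pres_rel_append_right) auto
  show "(u' @ v, u' @ v') \<in> pres_rel S R"
    using assms pres_rel_gwords[OF assms(1)] by (intro pres_rel_append_left) auto
qed

lemma carrier_presented_group:
  "carrier (presented_group S R) = gwords S // pres_rel S R"
  by (simp add: presented_group_def)

lemma one_presented_group: "\<one>\<^bsub>presented_group S R\<^esub> = pres_rel S R `` {[]}"
  by (simp add: presented_group_def)

lemma mult_presented_group:
  assumes u: "u \<in> gwords S" and v: "v \<in> gwords S"
  shows "(pres_rel S R `` {u}) \<otimes>\<^bsub>presented_group S R\<^esub> (pres_rel S R `` {v}) =
    pres_rel S R `` {u @ v}"
proof -
  have "congruent2 (pres_rel S R) (pres_rel S R) (\<lambda>a b. pres_rel S R `` {a @ b})"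
    by (intro congruent2I' equiv_class_eq[OF equiv_pres_rel] pres_rel_append)
  from UN_equiv_class2[OF equiv_pres_rel equiv_pres_rel this u v]
  show ?thesis by (simp add: presented_group_def)
qed

lemma inverse_gword:
  assumes "w \<in> gwords S"
  shows "map (map_prod id Not) (rev w) \<in> gwords S"
proof -
  have "set (map (map_prod id Not) (rev w)) \<subseteq> S \<times> UNIV"
    using assms by (auto simp: lists_eq_set)
  then show ?thesis by (simp add: lists_eq_set)
qed

lemma pres_rel_inverse:
  assumes "w \<in> gwords S"
  shows "(map (map_prod id Not) (rev w) @ w, []) \<in> pres_rel S R"
  using assms
proof (induction w rule: list.induct)
  case Nil
  then show ?case by (simp add: pres_rel.rel_refl)
next
  case (Cons x w)
  obtain s b where x: "x = (s, b)" by force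
  let ?i = "map (map_prod id Not) (rev w)"
  have w: "s \<in> S" "w \<in> gwords S" using Cons.prems x by auto
  have i: "?i \<in> gwords S" by (rule inverse_gword) (rule w)
  have "(?i @ [(s, \<not> b), (s, \<not> \<not> b)] @ w, ?i @ w) \<in> pres_rel S R"
    by (rule pres_rel.rel_cancel) (use i w in simp_all)
  then have "(map (map_prod id Not) (rev (x # w)) @ x # w, ?i @ w) \<in> pres_rel S R"
    by (simp add: x)
  moreover have "(?i @ w, []) \<in> pres_rel S R" using Cons.IH w by blast
  ultimately show ?case by (rule pres_rel.rel_trans)
qed

lemma group_presented_group: "group (presented_group S R)"
proof (rule groupI, goal_cases)
  case (1 x y)
  then obtain u v where "u \<in> gwords S" "v \<in> gwords S"
      "x = pres_rel S R `` {u}" "y = pres_rel S R `` {v}"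
    by (auto simp: carrier_presented_group elim!: quotientE)
  then show ?case
    by (simp add: mult_presented_group carrier_presented_group quotientI)
next
  case 2
  show ?case by (simp add: one_presented_group carrier_presented_group quotientI)
next
  case (3 x y z)
  then obtain u v w where "u \<in> gwords S" "v \<in> gwords S" "w \<in> gwords S"
      "x = pres_rel S R `` {u}" "y = pres_rel S R `` {v}" "z = pres_rel S R `` {w}"
    by (auto simp: carrier_presented_group elim!: quotientE)
  then show ?case by (simp add: mult_presented_group)
next
  case (4 x)
  then obtain u where "u \<in> gwords S" "x = pres_rel S R `` {u}"
    by (auto simp: carrier_presented_group elim!: quotientE)
  then show ?case by (simp add: mult_presented_group one_presented_group)
next
  case (5 x)
  then obtain u where u: "u \<in> gwords S" "x = pres_rel S R `` {u}"
    by (auto simp: carrier_presented_group elim!: quotientE)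
  let ?i = "map (map_prod id Not) (rev u)"
  have i: "?i \<in> gwords S" using u inverse_gword by blast
  have "pres_rel S R `` {?i} \<otimes>\<^bsub>presented_group S R\<^esub> x = \<one>\<^bsub>presented_group S R\<^esub>"
    using u i equiv_class_eq[OF equiv_pres_rel pres_rel_inverse[OF u(1)]]
    by (simp add: mult_presented_group one_presented_group)
  moreover have "pres_rel S R `` {?i} \<in> carrier (presented_group S R)"
    using i by (simp add: carrier_presented_group quotientI)
  ultimately show ?case by (rule bexI)
qed

lemma (in group) word_eval_closed:
  assumes f: "f \<in> S \<rightarrow> carrier G" and "w \<in> gwords S"
  shows "word_eval G f w \<in> carrier G"
  using assms(2)
proof (induction w rule: list.induct)
  case (Cons x w)
  then have "f (fst x) \<in> carrier G" "w \<in> gwords S" using f by (auto simp: Pi_iff)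
  then show ?case using Cons.IH by simp
qed simp

lemma (in group) word_eval_append:
  assumes f: "f \<in> S \<rightarrow> carrier G" and "v \<in> gwords S" "w \<in> gwords S"
  shows "word_eval G f (v @ w) = word_eval G f v \<otimes> word_eval G f w"
  using assms(2)
proof (induction v rule: list.induct)
  case Nil
  then show ?case using word_eval_closed[OF f assms(3)] by simp
next
  case (Cons x v)
  then have x: "f (fst x) \<in> carrier G" and v: "v \<in> gwords S" using f by (auto simp: Pi_iff)
  show ?case
    using Cons.IH[OF v] x word_eval_closed[OF f v] word_eval_closed[OF f assms(3)]
    by (simp add: m_assoc)
qed

lemma (in group) word_eval_cong:
  assumes f: "f \<in> S \<rightarrow> carrier G"
    and R: "\<forall>(l, r) \<in> R. word_eval G f l = word_eval G f r"
    and "(v, w) \<in> pres_rel S R"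
  shows "word_eval G f v = word_eval G f w"
  using assms(3)
proof (induction rule: pres_rel.induct)
  case (rel_cancel u v s b)
  let ?c = "[(s, b), (s, \<not> b)]"
  have c: "?c \<in> gwords S" and cv: "?c @ v \<in> gwords S" using rel_cancel by simp_all
  have "f s \<in> carrier G" using f rel_cancel(3) by (auto simp: Pi_iff)
  then have "word_eval G f ?c = \<one>" by (cases b) simp_all
  then have "word_eval G f (?c @ v) = word_eval G f v"
    using word_eval_append[OF f c rel_cancel(2)] word_eval_closed[OF f rel_cancel(2)] by simp
  then show ?case
    using word_eval_append[OF f rel_cancel(1) cv] word_eval_append[OF f rel_cancel(1,2)] by metis
next
  case (rel_relator u v l r)
  have lv: "l @ v \<in> gwords S" and rv: "r @ v \<in> gwords S" using rel_relator by simp_all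
  have "word_eval G f l = word_eval G f r" using R rel_relator(3) by blast
  then show ?case
    by (simp only: word_eval_append[OF f rel_relator(1) lv] word_eval_append[OF f rel_relator(1) rv]
        word_eval_append[OF f rel_relator(4,2)] word_eval_append[OF f rel_relator(5,2)])
qed simp_all

lemma (in group) pres_lift_class:
  assumes f: "f \<in> S \<rightarrow> carrier G"
    and R: "\<forall>(l, r) \<in> R. word_eval G f l = word_eval G f r"
    and w: "w \<in> gwords S"
  shows "pres_lift G f (pres_rel S R `` {w}) = word_eval G f w"
proof -
  have "word_eval G f v = word_eval G f w" if "(w, v) \<in> pres_rel S R" for v
    using word_eval_cong[OF f R that] by (rule sym)
  then have "word_eval G f ` (pres_rel S R `` {w}) \<subseteq> {word_eval G f w}"
    by blast
  moreover have "word_eval G f w \<in> word_eval G f ` (pres_rel S R `` {w})"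
    using pres_rel.rel_refl[OF w, of R] by blast
  ultimately have "word_eval G f ` (pres_rel S R `` {w}) = {word_eval G f w}"
    by blast
  then show ?thesis by (simp add: pres_lift_def)
qed

lemma (in group) pres_lift_hom:
  assumes f: "f \<in> S \<rightarrow> carrier G"
    and R: "\<forall>(l, r) \<in> R. word_eval G f l = word_eval G f r"
  shows "pres_lift G f \<in> hom (presented_group S R) G"
proof (rule homI)
  note cls = pres_lift_class[OF f R]
  fix x assume "x \<in> carrier (presented_group S R)"
  then obtain u where u: "u \<in> gwords S" "x = pres_rel S R `` {u}"
    unfolding carrier_presented_group by (rule quotientE)
  show "pres_lift G f x \<in> carrier G"
    unfolding u(2) cls[OF u(1)] by (rule word_eval_closed[OF f u(1)])
  fix y assume "y \<in> carrier (presented_group S R)"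
  then obtain v where v: "v \<in> gwords S" "y = pres_rel S R `` {v}"
    unfolding carrier_presented_group by (rule quotientE)
  have uv: "u @ v \<in> gwords S" using u v by simp
  show "pres_lift G f (x \<otimes>\<^bsub>presented_group S R\<^esub> y) = pres_lift G f x \<otimes> pres_lift G f y"
    unfolding u(2) v(2) mult_presented_group[OF u(1) v(1)] cls[OF u(1)] cls[OF v(1)] cls[OF uv]
    by (rule word_eval_append[OF f u(1) v(1)])
qed

lemma (in group) pres_lift_gen:
  assumes f: "f \<in> S \<rightarrow> carrier G"
    and R: "\<forall>(l, r) \<in> R. word_eval G f l = word_eval G f r"
    and s: "s \<in> S"
  shows "pres_lift G f (pres_gen S R s) = f s"
proof -
  have "[(s, True)] \<in> gwords S" "f s \<in> carrier G" using f s by (auto simp: Pi_iff)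
  then show ?thesis using pres_lift_class[OF f R, of "[(s, True)]"] by (simp add: pres_gen_def)
qed


section \<open>Artin's braid group\<close>

definition braid_relations :: "nat \<Rightarrow> (nat gword \<times> nat gword) set" where
  "braid_relations n =
    {([(i, True), (j, True)], [(j, True), (i, True)]) | i j.
       1 \<le> i \<and> i < n \<and> 1 \<le> j \<and> j < n \<and> (i + 2 \<le> j \<or> j + 2 \<le> i)} \<union>
    {([(i, True), (i + 1, True), (i, True)], [(i + 1, True), (i, True), (i + 1, True)]) | i.
       1 \<le> i \<and> i + 2 \<le> n}"

definition braid_group :: "nat \<Rightarrow> nat gword set monoid" where
  "braid_group n = presented_group {1..<n} (braid_relations n)"

lemma group_braid_group: "group (braid_group n)"
  by (simp add: braid_group_def group_presented_group)


section \<open>Matrix representations\<close>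

abbreviation GL :: "nat \<Rightarrow> complex mat monoid" where
  "GL N \<equiv> units_of (ring_mat TYPE(complex) N ())"

lemma group_GL: "group (GL N)"
proof -
  interpret ring "ring_mat TYPE(complex) N ()" by (rule ring_mat)
  show ?thesis by (rule units_group)
qed

definition representation :: "('g, 'm) monoid_scheme \<Rightarrow> nat \<Rightarrow> ('g \<Rightarrow> complex mat) \<Rightarrow> bool" where
  "representation G N \<rho> \<longleftrightarrow> \<rho> \<in> hom G (GL N)"

definition isomorphic_reps ::
    "('g, 'm) monoid_scheme \<Rightarrow> nat \<Rightarrow> ('g \<Rightarrow> complex mat) \<Rightarrow> ('g \<Rightarrow> complex mat) \<Rightarrow> bool" where
  "isomorphic_reps G N \<rho> \<rho>' \<longleftrightarrow>
    representation G N \<rho> \<and> representation G N \<rho>' \<and>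
    (\<exists>P \<in> carrier (GL N). \<forall>g \<in> carrier G. P * \<rho> g = \<rho>' g * P)"

text \<open>Tensor products follow the "left into right" convention: \<open>X \<otimes>\<^sub>k A\<close> is the block matrix
  whose \<open>(i, j)\<close> block is \<open>A\<^sub>i\<^sub>j X\<close>.\<close>

definition kron :: "complex mat \<Rightarrow> complex mat \<Rightarrow> complex mat"  (infixl \<open>\<otimes>\<^sub>k\<close> 70) where
  "X \<otimes>\<^sub>k A = mat (dim_row X * dim_row A) (dim_col X * dim_col A)
    (\<lambda>(p, q). A $$ (p div dim_row X, q div dim_col X) * X $$ (p mod dim_row X, q mod dim_col X))"

primrec tensor_power :: "complex mat \<Rightarrow> nat \<Rightarrow> complex mat" where
  "tensor_power A 0 = 1\<^sub>m 1"
| "tensor_power A (Suc m) = tensor_power A m \<otimes>\<^sub>k A"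

abbreviation I2pow :: "nat \<Rightarrow> complex mat" where
  "I2pow m \<equiv> tensor_power (1\<^sub>m 2) m"

lemma kron_one_one: "1\<^sub>m a \<otimes>\<^sub>k 1\<^sub>m b = 1\<^sub>m (a * b)"
proof (rule eq_matI)
  fix i j assume "i < dim_row (1\<^sub>m (a * b) :: complex mat)" "j < dim_col (1\<^sub>m (a * b) :: complex mat)"
  then have ij: "i < a * b" "j < a * b" by simp_all
  then have a: "a > 0" by (cases "a = 0") simp_all
  have b: "i div a < b" "j div a < b"
    using ij by (simp_all only: less_mult_imp_div_less mult.commute[of a b])
  have m: "i mod a < a" "j mod a < a"
    using a by (rule mod_less_divisor)+
  have eq: "i = j" if "i div a = j div a" "i mod a = j mod a"
    using div_mult_mod_eq[of i a] div_mult_mod_eq[of j a] unfolding that by simp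
  have "(1\<^sub>m a \<otimes>\<^sub>k 1\<^sub>m b) $$ (i, j) =
      (1\<^sub>m b :: complex mat) $$ (i div a, j div a) * 1\<^sub>m a $$ (i mod a, j mod a)"
    unfolding kron_def by (simp only: index_one_mat(2,3) index_mat(1)[OF ij] split)
  also have "\<dots> = (if i div a = j div a then 1 else 0) * (if i mod a = j mod a then 1 else 0)"
    by (simp only: index_one_mat(1)[OF b] index_one_mat(1)[OF m])
  also have "\<dots> = (if i = j then 1 else 0)"
  proof (cases "i = j")
    case False
    then have "\<not> (i div a = j div a \<and> i mod a = j mod a)" using eq by blast
    then show ?thesis using False by auto
  qed simp
  also have "\<dots> = 1\<^sub>m (a * b) $$ (i, j)"
    by (simp only: index_one_mat(1)[OF ij])
  finally show "(1\<^sub>m a \<otimes>\<^sub>k 1\<^sub>m b) $$ (i, j) = 1\<^sub>m (a * b) $$ (i, j)" .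
qed (simp_all add: kron_def)

lemma I2pow_eq: "I2pow m = 1\<^sub>m (2 ^ m)"
  by (induction m) (simp_all add: kron_one_one mult.commute)

lemma kron_2x2:
  assumes "X \<in> carrier_mat r c"
  shows "X \<otimes>\<^sub>k mat_of_rows_list 2 [[\<alpha>, \<beta>], [\<gamma>, \<delta>]] =
    four_block_mat (\<alpha> \<cdot>\<^sub>m X) (\<beta> \<cdot>\<^sub>m X) (\<gamma> \<cdot>\<^sub>m X) (\<delta> \<cdot>\<^sub>m X)"
proof (rule eq_matI)
  let ?B = "four_block_mat (\<alpha> \<cdot>\<^sub>m X) (\<beta> \<cdot>\<^sub>m X) (\<gamma> \<cdot>\<^sub>m X) (\<delta> \<cdot>\<^sub>m X)"
  fix i j assume "i < dim_row ?B" "j < dim_col ?B"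
  then have ij: "i < r * 2" "j < c * 2" using assms by simp_all
  have dm: "m div t = (if m < t then 0 else 1) \<and> m mod t = (if m < t then m else m - t)"
    if "m < t * 2" for m t :: nat
  proof (cases "m < t")
    case False
    then obtain e where "m = t + e" by (auto simp: not_less le_iff_add)
    with that show ?thesis by simp
  qed simp
  show "(X \<otimes>\<^sub>k mat_of_rows_list 2 [[\<alpha>, \<beta>], [\<gamma>, \<delta>]]) $$ (i, j) = ?B $$ (i, j)"
    using ij assms dm[OF ij(1)] dm[OF ij(2)] by (simp add: kron_def mat_of_rows_list_def)
qed (use assms in \<open>simp_all add: kron_def mat_of_rows_list_def\<close>)

definition trivial_rep :: "nat \<Rightarrow> 'g \<Rightarrow> complex mat" where
  "trivial_rep N g = 1\<^sub>m N"

definition tensor_rep :: "('g \<Rightarrow> complex mat) \<Rightarrow> ('g \<Rightarrow> complex mat) \<Rightarrow> 'g \<Rightarrow> complex mat" where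
  "tensor_rep \<rho> \<rho>' g = \<rho> g \<otimes>\<^sub>k \<rho>' g"

definition direct_sum_rep :: "('g \<Rightarrow> complex mat) \<Rightarrow> ('g \<Rightarrow> complex mat) \<Rightarrow> 'g \<Rightarrow> complex mat" where
  "direct_sum_rep \<rho> \<rho>' g = diag_block_mat [\<rho> g, \<rho>' g]"

text \<open>The representation of the braid group on \<open>\<complex>\<^sup>N\<close> sending the \<open>i\<close>-th generator to \<open>f i\<close>,
  provided the \<open>f i\<close> are invertible and satisfy the braid relations.\<close>

definition braid_rep :: "nat \<Rightarrow> (nat \<Rightarrow> complex mat) \<Rightarrow> nat gword set \<Rightarrow> complex mat" where
  "braid_rep N f = pres_lift (GL N) f"


section \<open>The representations of the braid groups\<close>

definition inv_sqrt2 :: complex where "inv_sqrt2 = complex_of_real (1 / sqrt 2)"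

definition R_mat :: "complex mat" where
  "R_mat = inv_sqrt2 \<cdot>\<^sub>m mat_of_rows_list 4
    [[ 1, 0,  0, 1],
     [ 0, 1, -1, 0],
     [ 0, 1,  1, 0],
     [-1, 0,  0, 1]]"

definition pi_gen :: "nat \<Rightarrow> nat \<Rightarrow> complex mat" where
  "pi_gen n i = I2pow (i - 1) \<otimes>\<^sub>k R_mat \<otimes>\<^sub>k I2pow (n - i - 1)"

definition pi_rep :: "nat \<Rightarrow> nat gword set \<Rightarrow> complex mat" where
  "pi_rep n = braid_rep (2 ^ n) (pi_gen n)"

definition s_mat :: "complex mat" where
  "s_mat = mat_of_rows_list 2 [[0, 1], [-1, 0]]"

definition sigma_z :: "complex mat" where
  "sigma_z = mat_of_rows_list 2 [[1, 0], [0, -1]]"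

definition zeta :: complex where "zeta = inv_sqrt2 * (1 + \<i>)"

definition d_mat :: "complex mat" where
  "d_mat = mat_of_rows_list 2 [[zeta, 0], [0, cnj zeta]]"

definition D_mat :: "complex mat" where
  "D_mat = mat_of_rows_list 4
    [[zeta, 0, 0, 0],
     [0, cnj zeta, 0, 0],
     [0, 0, cnj zeta, 0],
     [0, 0, 0, zeta]]"

definition M_mat :: "complex mat" where
  "M_mat = inv_sqrt2 \<cdot>\<^sub>m mat_of_rows_list 2 [[1, 1], [-1, 1]]"

text \<open>Here \<open>n = 2k + 1\<close> with \<open>k \<ge> 1\<close>, and \<open>1 \<le> j \<le> 2k\<close>.\<close>

definition rho_gen :: "nat \<Rightarrow> nat \<Rightarrow> complex mat" where
  "rho_gen k j =
    (let i = j div 2 in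
     if j = 1 then d_mat \<otimes>\<^sub>k I2pow (k - 1)
     else if even j then I2pow (i - 1) \<otimes>\<^sub>k M_mat \<otimes>\<^sub>k I2pow (k - i)
     else I2pow (i - 1) \<otimes>\<^sub>k D_mat \<otimes>\<^sub>k I2pow (k - i - 1))"

definition V1_rep :: "nat \<Rightarrow> nat gword set \<Rightarrow> complex mat" where
  "V1_rep n = (let k = (n - 1) div 2 in braid_rep (2 ^ k) (rho_gen k))"

text \<open>Here \<open>n = 2k\<close> with \<open>k \<ge> 1\<close>, and \<open>1 \<le> j \<le> 2k - 1\<close>. The images of \<open>x\<^sub>j\<close> under
  \<open>\<lambda>\<^sub>1\<close> and \<open>\<lambda>\<^sub>2\<close> differ only by a sign for \<open>j = 2k - 1\<close>; \<open>\<epsilon> = 1\<close> gives \<open>\<lambda>\<^sub>1\<close> and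
  \<open>\<epsilon> = -1\<close> gives \<open>\<lambda>\<^sub>2\<close>.\<close>

definition lambda_x :: "complex \<Rightarrow> nat \<Rightarrow> nat \<Rightarrow> complex mat" where
  "lambda_x \<epsilon> k j =
    (let i = j div 2 in
     if k = 1 then (\<epsilon> * \<i>) \<cdot>\<^sub>m 1\<^sub>m 1
     else if j = 1 then \<i> \<cdot>\<^sub>m (sigma_z \<otimes>\<^sub>k I2pow (k - 2))
     else if even j then I2pow (i - 1) \<otimes>\<^sub>k s_mat \<otimes>\<^sub>k I2pow (k - i - 1)
     else if j = 2 * k - 1 then (\<epsilon> * \<i>) \<cdot>\<^sub>m (I2pow (k - 2) \<otimes>\<^sub>k sigma_z)
     else \<i> \<cdot>\<^sub>m (I2pow (i - 1) \<otimes>\<^sub>k sigma_z \<otimes>\<^sub>k sigma_z \<otimes>\<^sub>k I2pow (k - i - 2)))"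

definition lambda_gen :: "complex \<Rightarrow> nat \<Rightarrow> nat \<Rightarrow> complex mat" where
  "lambda_gen \<epsilon> k j = inv_sqrt2 \<cdot>\<^sub>m (lambda_x \<epsilon> k j + 1\<^sub>m (2 ^ (k - 1)))"

definition W1_rep :: "nat \<Rightarrow> nat gword set \<Rightarrow> complex mat" where
  "W1_rep n = (let k = n div 2 in braid_rep (2 ^ (k - 1)) (lambda_gen 1 k))"

definition W2_rep :: "nat \<Rightarrow> nat gword set \<Rightarrow> complex mat" where
  "W2_rep n = (let k = n div 2 in braid_rep (2 ^ (k - 1)) (lambda_gen (-1) k))"

end

theory Submission
  imports Defs "Jordan_Normal_Form.Determinant"
begin

text \<open>Every generator, on either side, has the form \<open>(1 + x\<^sub>i) / \<surd>2\<close>, where \<open>x\<^sub>i\<close> is a signed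
  permutation matrix (up to powers of \<open>\<i>\<close>) that flips some bits of the index and multiplies by a phase
  depending on the bits. The \<open>x\<^sub>i\<close> square to \<open>-1\<close>, neighbours anticommute and distant ones commute,
  which gives the braid relations. An intertwiner of the \<open>x\<^sub>i\<close> can be written down: group the
  bits on the left-hand side into consecutive pairs; then its entries are products with one factor
  per pair. An odd generator changes a single factor and an even one two adjacent factors, so the
  intertwining property is a finite check. The Gram matrix of the rows also factors over the pairs
  and is a multiple of the identity. For even \<open>n\<close>, \<open>W\<^sub>1 \<oplus> W\<^sub>2\<close> is given by the formulas for \<open>V\<^sub>1\<close>, the
  top bit of the index selecting the summand.\<close>

section \<open>Monomial matrices and Kronecker products\<close>

text \<open>With indices read as bit strings, this matrix sends the basis vector at \<open>q\<close>
  to \<open>\<phi> q\<close> times the one at \<open>xor q \<mu>\<close>: a diagonal matrix followed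
  by bit flips on the mask \<open>\<mu>\<close>. The class is closed under products and tensor
  products, so relations between such matrices become identities between masks and phases.\<close>

definition pauli :: "nat \<Rightarrow> nat \<Rightarrow> (nat \<Rightarrow> complex) \<Rightarrow> complex mat" where
  "pauli a \<mu> \<phi> = mat (2 ^ a) (2 ^ a) (\<lambda>(p, q). if p = xor q \<mu> then \<phi> q else 0)"

lemma pauli_carrier [simp]: "pauli a \<mu> \<phi> \<in> carrier_mat (2 ^ a) (2 ^ a)"
  by (simp add: pauli_def)

lemma dim_pauli [simp]: "dim_row (pauli a \<mu> \<phi>) = 2 ^ a" "dim_col (pauli a \<mu> \<phi>) = 2 ^ a"
  by (simp_all add: pauli_def)

lemma pauli_cong: "\<mu> = \<nu> \<Longrightarrow> (\<And>q. q < 2 ^ a \<Longrightarrow> \<phi> q = \<psi> q) \<Longrightarrow> pauli a \<mu> \<phi> = pauli a \<nu> \<psi>"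
  by (auto simp: pauli_def intro!: cong_mat)

lemma one_eq_pauli: "1\<^sub>m (2 ^ a) = pauli a 0 (\<lambda>_. 1)"
  by (rule eq_matI) (auto simp: pauli_def)

lemma smult_pauli: "c \<cdot>\<^sub>m pauli a \<mu> \<phi> = pauli a \<mu> (\<lambda>q. c * \<phi> q)"
  by (rule eq_matI) (auto simp: pauli_def)

lemma uminus_pauli: "- pauli a \<mu> \<phi> = pauli a \<mu> (\<lambda>q. - \<phi> q)"
  by (rule eq_matI) (auto simp: pauli_def)

lemma xor_less_two_power: "p < 2 ^ a \<Longrightarrow> q < 2 ^ a \<Longrightarrow> xor p q < (2 ^ a :: nat)"
  by (metis take_bit_nat_eq_self_iff take_bit_xor)

lemma nat_eq_take_drop_bit: "(p :: nat) = q \<longleftrightarrow> take_bit a p = take_bit a q \<and> drop_bit a p = drop_bit a q"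
  by (metis bits_ident)

lemma drop_bit_nat_eq_0: "q < 2 ^ a \<Longrightarrow> drop_bit a q = (0 :: nat)"
  by (simp add: drop_bit_eq_div)

lemma drop_bit_push_bit_nat: "drop_bit a (push_bit a \<nu>) = (\<nu>::nat)"
  by (simp add: drop_bit_eq_div push_bit_eq_mult)

lemma take_bit_push_bit_nat: "take_bit a (push_bit a \<nu>) = (0::nat)"
  by (simp add: take_bit_eq_mod push_bit_eq_mult)

lemma take_bit_xor_push_bit: assumes "\<mu> < 2 ^ a"
  shows "take_bit a (xor q (xor \<mu> (push_bit a \<nu>))) = xor (take_bit a q) (\<mu>::nat)"
  unfolding take_bit_xor take_bit_push_bit_nat take_bit_nat_eq_self[OF assms] by simp

lemma drop_bit_xor_push_bit: assumes "\<mu> < 2 ^ a"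
  shows "drop_bit a (xor q (xor \<mu> (push_bit a \<nu>))) = xor (drop_bit a q) (\<nu>::nat)"
  unfolding drop_bit_xor drop_bit_push_bit_nat drop_bit_nat_eq_0[OF assms] by simp
lemma not_bit_high: "w < 2 ^ N \<Longrightarrow> N \<le> j \<Longrightarrow> \<not> bit (w :: nat) j"
  by (metis bit_take_bit_iff linorder_not_le take_bit_nat_eq_self)

lemma xor_xor_cancel: "xor (xor p q) q = (p :: nat)"
  by (simp add: xor.assoc)

lemma pauli_times_index:
  assumes "P \<in> carrier_mat (2 ^ a) c" "p < 2 ^ a" "q < c" "\<mu> < 2 ^ a"
  shows "(pauli a \<mu> \<phi> * P) $$ (p, q) = \<phi> (xor p \<mu>) * P $$ (xor p \<mu>, q)"
proof -
  have "(pauli a \<mu> \<phi> * P) $$ (p, q) =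
      (\<Sum>r<2 ^ a. (if p = xor r \<mu> then \<phi> r else 0) * P $$ (r, q))"
    using assms by (simp add: pauli_def scalar_prod_def lessThan_atLeast0)
  also have "\<dots> = (\<Sum>r<2 ^ a. if r = xor p \<mu> then \<phi> r * P $$ (r, q) else 0)"
    by (rule sum.cong) (auto simp: xor_xor_cancel)
  also have "\<dots> = \<phi> (xor p \<mu>) * P $$ (xor p \<mu>, q)"
    using xor_less_two_power[OF assms(2,4)] by simp
  finally show ?thesis .
qed

lemma times_pauli_index:
  assumes "P \<in> carrier_mat r (2 ^ a)" "p < r" "q < 2 ^ a" "\<mu> < 2 ^ a"
  shows "(P * pauli a \<mu> \<phi>) $$ (p, q) = P $$ (p, xor q \<mu>) * \<phi> q"
proof -
  have "(P * pauli a \<mu> \<phi>) $$ (p, q) =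
      (\<Sum>r<2 ^ a. P $$ (p, r) * (if r = xor q \<mu> then \<phi> q else 0))"
    using assms by (simp add: pauli_def scalar_prod_def lessThan_atLeast0)
  also have "\<dots> = (\<Sum>r<2 ^ a. if r = xor q \<mu> then P $$ (p, r) * \<phi> q else 0)"
    by (rule sum.cong) auto
  also have "\<dots> = P $$ (p, xor q \<mu>) * \<phi> q"
    using xor_less_two_power[OF assms(3,4)] by simp
  finally show ?thesis .
qed

text \<open>The right factor acts first, so the left one reads its phase at the index already
  flipped by \<open>\<nu>\<close>.\<close>

lemma pauli_mult:
  assumes "\<mu> < 2 ^ a" "\<nu> < 2 ^ a"
  shows "pauli a \<mu> \<phi> * pauli a \<nu> \<psi> = pauli a (xor \<mu> \<nu>) (\<lambda>q. \<phi> (xor q \<nu>) * \<psi> q)"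
proof (rule eq_matI)
  fix p q assume "p < dim_row (pauli a (xor \<mu> \<nu>) (\<lambda>q. \<phi> (xor q \<nu>) * \<psi> q))"
    "q < dim_col (pauli a (xor \<mu> \<nu>) (\<lambda>q. \<phi> (xor q \<nu>) * \<psi> q))"
  then have "p < 2 ^ a" "q < 2 ^ a" by simp_all
  then show "(pauli a \<mu> \<phi> * pauli a \<nu> \<psi>) $$ (p, q) =
      pauli a (xor \<mu> \<nu>) (\<lambda>q. \<phi> (xor q \<nu>) * \<psi> q) $$ (p, q)"
    using assms xor_less_two_power[of q a \<nu>]
    by (subst times_pauli_index[where r = "2 ^ a"]) (auto simp: pauli_def ac_simps)
qed simp_all

lemma mod_less_of_less_mult: "p < a * b \<Longrightarrow> p mod a < (a :: nat)"
  by (metis less_nat_zero_code mod_less_divisor mult_0 neq0_conv)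

lemma div_less_of_less_mult: "p < a * b \<Longrightarrow> p div a < (b :: nat)"
  by (rule less_mult_imp_div_less) (simp only: mult.commute)

text \<open>In the "left into right" convention the left factor owns the low \<open>a\<close> bits
  and the right factor the bits above them. The bound on \<open>\<mu>\<close> keeps the left mask
  out of the bits of the right factor.\<close>

lemma pauli_kron:
  assumes "\<mu> < 2 ^ a"
  shows "pauli a \<mu> \<phi> \<otimes>\<^sub>k pauli b \<nu> \<psi> =
    pauli (a + b) (xor \<mu> (push_bit a \<nu>)) (\<lambda>q. \<phi> (take_bit a q) * \<psi> (drop_bit a q))"
    (is "?L = ?R")
proof (rule eq_matI)
  fix p q assume "p < dim_row ?R" "q < dim_col ?R"
  then have pq: "p < 2 ^ a * 2 ^ b" "q < 2 ^ a * 2 ^ b" by (simp_all only: dim_pauli power_add)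
  have "?L $$ (p, q) = pauli b \<nu> \<psi> $$ (drop_bit a p, drop_bit a q) *
      pauli a \<mu> \<phi> $$ (take_bit a p, take_bit a q)"
    unfolding kron_def dim_pauli unfolding index_mat(1)[OF pq] drop_bit_eq_div take_bit_eq_mod
    by (simp only: prod.case)
  also have "\<dots> = (if drop_bit a p = xor (drop_bit a q) \<nu> then \<psi> (drop_bit a q) else 0) *
      (if take_bit a p = xor (take_bit a q) \<mu> then \<phi> (take_bit a q) else 0)"
  proof -
    have "drop_bit a p < 2 ^ b" "drop_bit a q < 2 ^ b"
      using pq[THEN div_less_of_less_mult] by (simp_all only: drop_bit_eq_div)
    then show ?thesis by (simp add: pauli_def)
  qed
  also have "\<dots> = ?R $$ (p, q)"
  proof -
    have "p = xor q (xor \<mu> (push_bit a \<nu>)) \<longleftrightarrow>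
        take_bit a p = xor (take_bit a q) \<mu> \<and> drop_bit a p = xor (drop_bit a q) \<nu>"
      unfolding nat_eq_take_drop_bit[of p _ a] take_bit_xor_push_bit[OF assms]
        drop_bit_xor_push_bit[OF assms] ..
    then have "?R $$ (p, q) = (if take_bit a p = xor (take_bit a q) \<mu> \<and>
        drop_bit a p = xor (drop_bit a q) \<nu> then \<phi> (take_bit a q) * \<psi> (drop_bit a q) else 0)"
      using pq unfolding pauli_def power_add by (simp only: index_mat(1) prod.case)
    moreover have "(if P then x else 0) * (if Q then y else 0) = (if Q \<and> P then y * x else 0)"
      for P Q and x y :: complex by simp
    ultimately show ?thesis by (simp only:)
  qed
  finally show "?L $$ (p, q) = ?R $$ (p, q)" .
qed (simp_all only: kron_def power_add dim_pauli dim_row_mat dim_col_mat)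

section \<open>Bilinearity and the mixed-product rule for Kronecker products\<close>

lemma kron_carrier [simp]:
  "A \<in> carrier_mat a b \<Longrightarrow> B \<in> carrier_mat c d \<Longrightarrow> A \<otimes>\<^sub>k B \<in> carrier_mat (a * c) (b * d)"
  by (intro carrier_matI) (simp_all add: kron_def)

lemma kron_smult_right: "A \<otimes>\<^sub>k (c \<cdot>\<^sub>m B) = c \<cdot>\<^sub>m (A \<otimes>\<^sub>k B)"
  by (rule eq_matI) (auto simp: kron_def div_less_of_less_mult)

lemma kron_smult_left: "(c \<cdot>\<^sub>m A) \<otimes>\<^sub>k B = c \<cdot>\<^sub>m (A \<otimes>\<^sub>k B)"
  by (rule eq_matI) (auto simp: kron_def mod_less_of_less_mult)

lemma kron_add_right:
  "B \<in> carrier_mat r c \<Longrightarrow> B' \<in> carrier_mat r c \<Longrightarrow> A \<otimes>\<^sub>k (B + B') = A \<otimes>\<^sub>k B + A \<otimes>\<^sub>k B'"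
  by (rule eq_matI) (auto simp: kron_def div_less_of_less_mult algebra_simps)

lemma kron_add_left:
  "A \<in> carrier_mat r c \<Longrightarrow> A' \<in> carrier_mat r c \<Longrightarrow> (A + A') \<otimes>\<^sub>k B = A \<otimes>\<^sub>k B + A' \<otimes>\<^sub>k B"
  by (rule eq_matI) (auto simp: kron_def mod_less_of_less_mult algebra_simps)

lemma kron_mult:
  assumes "A \<in> carrier_mat a b" "B \<in> carrier_mat a' b'" "C \<in> carrier_mat b c" "D \<in> carrier_mat b' c'"
  shows "(A \<otimes>\<^sub>k B) * (C \<otimes>\<^sub>k D) = (A * C) \<otimes>\<^sub>k (B * D)"
proof (rule eq_matI)
  fix i j assume "i < dim_row ((A * C) \<otimes>\<^sub>k (B * D))" "j < dim_col ((A * C) \<otimes>\<^sub>k (B * D))"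
  then have ij: "i < a * a'" "j < c * c'" using assms by (simp_all add: kron_def)
  note less = mod_less_of_less_mult[OF ij(1)] mod_less_of_less_mult[OF ij(2)]
    div_less_of_less_mult[OF ij(1)] div_less_of_less_mult[OF ij(2)]
  define f where "f y x = B $$ (i div a, y) * A $$ (i mod a, x) * (D $$ (y, j div c) * C $$ (x, j mod c))" for x y
  have "((A \<otimes>\<^sub>k B) * (C \<otimes>\<^sub>k D)) $$ (i, j) = (\<Sum>r<b' * b. f (r div b) (r mod b))"
    using assms ij unfolding mult.commute[of b' b]
    by (simp add: kron_def scalar_prod_def lessThan_atLeast0 f_def)
  \<comment> \<open>The summation index is \<open>r = y * b + x\<close>, where \<open>x\<close> is
    the inner index for the left factors and \<open>y\<close> that for the right ones.\<close>
  also have "\<dots> = (\<Sum>y<b'. \<Sum>r\<in>{y * b..<y * b + b}. f (r div b) (r mod b))"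
    by (rule sum.nat_group[symmetric])
  also have "\<dots> = (\<Sum>y<b'. \<Sum>x<b. f y x)"
  proof (rule sum.cong[OF refl])
    fix y
    have "(y * b + x) div b = y" "(y * b + x) mod b = x" if "x < b" for x
      using that by simp_all
    then have "(\<Sum>x<b. f y x) = (\<Sum>r\<in>{y * b..<y * b + b}. f (r div b) (r mod b))"
      by (intro sum.reindex_bij_witness[of _ "\<lambda>r. r - y * b" "\<lambda>x. y * b + x"]) auto
    then show "(\<Sum>r\<in>{y * b..<y * b + b}. f (r div b) (r mod b)) = (\<Sum>x<b. f y x)" ..
  qed
  also have "\<dots> = (\<Sum>y<b'. B $$ (i div a, y) * D $$ (y, j div c)) *
      (\<Sum>x<b. A $$ (i mod a, x) * C $$ (x, j mod c))"
    unfolding sum_product f_def by (intro sum.cong refl) (simp add: ac_simps)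
  also have "\<dots> = ((A * C) \<otimes>\<^sub>k (B * D)) $$ (i, j)"
    using assms ij less by (simp add: kron_def scalar_prod_def lessThan_atLeast0)
  finally show "((A \<otimes>\<^sub>k B) * (C \<otimes>\<^sub>k D)) $$ (i, j) = ((A * C) \<otimes>\<^sub>k (B * D)) $$ (i, j)" .
qed (use assms in \<open>simp_all add: kron_def\<close>)

section \<open>Representations of the braid group\<close>

text \<open>The elements at which \<open>P\<close> intertwines are closed under products and
  inverses. Since every element is the class of a word in the generators and their inverses,
  checking generators suffices.\<close>

lemma presented_group_hom_intertwine:
  assumes H: "group H" and \<rho>: "\<rho> \<in> hom (presented_group S R) H" and \<rho>': "\<rho>' \<in> hom (presented_group S R) H"
    and P: "P \<in> carrier H"
    and gen: "\<And>s. s \<in> S \<Longrightarrow> P \<otimes>\<^bsub>H\<^esub> \<rho> (pres_gen S R s) = \<rho>' (pres_gen S R s) \<otimes>\<^bsub>H\<^esub> P"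
    and g: "g \<in> carrier (presented_group S R)"
  shows "P \<otimes>\<^bsub>H\<^esub> \<rho> g = \<rho>' g \<otimes>\<^bsub>H\<^esub> P"
proof -
  let ?G = "presented_group S R" and ?c = "\<lambda>w. pres_rel S R `` {w}"
  interpret H: group H by (rule H)
  interpret G: group ?G by (rule group_presented_group)
  interpret r: group_hom ?G H \<rho> by unfold_locales (rule \<rho>)
  interpret r': group_hom ?G H \<rho>' by unfold_locales (rule \<rho>')
  have car: "?c w \<in> carrier ?G" if "w \<in> gwords S" for w
    using that by (simp add: carrier_presented_group quotientI)
  have mult: "P \<otimes>\<^bsub>H\<^esub> \<rho> (x \<otimes>\<^bsub>?G\<^esub> y) = \<rho>' (x \<otimes>\<^bsub>?G\<^esub> y) \<otimes>\<^bsub>H\<^esub> P"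
    if "x \<in> carrier ?G" "y \<in> carrier ?G"
      "P \<otimes>\<^bsub>H\<^esub> \<rho> x = \<rho>' x \<otimes>\<^bsub>H\<^esub> P" "P \<otimes>\<^bsub>H\<^esub> \<rho> y = \<rho>' y \<otimes>\<^bsub>H\<^esub> P" for x y
  proof -
    have "P \<otimes>\<^bsub>H\<^esub> \<rho> (x \<otimes>\<^bsub>?G\<^esub> y) = (P \<otimes>\<^bsub>H\<^esub> \<rho> x) \<otimes>\<^bsub>H\<^esub> \<rho> y"
      using that(1,2) P by (simp add: H.m_assoc)
    also have "\<dots> = \<rho>' x \<otimes>\<^bsub>H\<^esub> (P \<otimes>\<^bsub>H\<^esub> \<rho> y)"
      unfolding that(3) using that(1,2) P by (simp add: H.m_assoc)
    also have "\<dots> = \<rho>' (x \<otimes>\<^bsub>?G\<^esub> y) \<otimes>\<^bsub>H\<^esub> P"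
      unfolding that(4) using that(1,2) P by (simp add: H.m_assoc)
    finally show ?thesis .
  qed
  \<comment> \<open>Multiplied on the left by \<open>\<rho>' x\<close>, both sides become
    \<open>P\<close>; then \<open>\<rho>' x\<close> is cancelled.\<close>
  have inv: "P \<otimes>\<^bsub>H\<^esub> \<rho> (inv\<^bsub>?G\<^esub> x) = \<rho>' (inv\<^bsub>?G\<^esub> x) \<otimes>\<^bsub>H\<^esub> P"
    if x: "x \<in> carrier ?G" and eq: "P \<otimes>\<^bsub>H\<^esub> \<rho> x = \<rho>' x \<otimes>\<^bsub>H\<^esub> P" for x
  proof -
    have "\<rho>' x \<otimes>\<^bsub>H\<^esub> (P \<otimes>\<^bsub>H\<^esub> \<rho> (inv\<^bsub>?G\<^esub> x)) = (P \<otimes>\<^bsub>H\<^esub> \<rho> x) \<otimes>\<^bsub>H\<^esub> \<rho> (inv\<^bsub>?G\<^esub> x)"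
      unfolding eq using x P by (simp add: H.m_assoc del: r.hom_inv)
    also have "\<dots> = P" using x P by (simp add: H.m_assoc)
    also have "\<dots> = \<rho>' x \<otimes>\<^bsub>H\<^esub> (\<rho>' (inv\<^bsub>?G\<^esub> x) \<otimes>\<^bsub>H\<^esub> P)"
      using x P by (simp add: H.m_assoc[symmetric])
    finally show ?thesis using x P by (simp del: r.hom_inv r'.hom_inv)
  qed
  have step: "P \<otimes>\<^bsub>H\<^esub> \<rho> (?c [(s, b)]) = \<rho>' (?c [(s, b)]) \<otimes>\<^bsub>H\<^esub> P" if s: "s \<in> S" for s b
  proof (cases b)
    case True
    then show ?thesis using gen[OF s] by (simp add: pres_gen_def)
  next
    case False
    \<comment> \<open>The class of a formal inverse letter is the inverse in the group, because the
      two-letter word cancels.\<close>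
    have "?c [(s, False)] \<otimes>\<^bsub>?G\<^esub> ?c [(s, True)] = \<one>\<^bsub>?G\<^esub>"
      using s equiv_class_eq[OF equiv_pres_rel pres_rel_inverse[of "[(s, True)]" S R]]
      by (simp add: mult_presented_group one_presented_group)
    then have "?c [(s, False)] = inv\<^bsub>?G\<^esub> ?c [(s, True)]"
      using s by (intro G.inv_equality[symmetric] car) auto
    then show ?thesis
      using inv[of "?c [(s, True)]"] gen[OF s] car[of "[(s, True)]"] s False
      by (simp add: pres_gen_def)
  qed
  have "P \<otimes>\<^bsub>H\<^esub> \<rho> (?c w) = \<rho>' (?c w) \<otimes>\<^bsub>H\<^esub> P" if "w \<in> gwords S" for w
    using that
  proof (induction w rule: list.induct)
    case Nil
    show ?case using P r.hom_one r'.hom_one by (simp add: one_presented_group)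
  next
    case (Cons x w)
    then have "fst x \<in> S" "w \<in> gwords S" by auto
    moreover have "?c (x # w) = ?c [x] \<otimes>\<^bsub>?G\<^esub> ?c w"
      using Cons.prems by (subst mult_presented_group) auto
    moreover have "[x] \<in> gwords S" using Cons.prems by simp
    ultimately show ?case
      using mult[OF car[of "[x]"] car[of w]] step[of "fst x" "snd x"] Cons.IH by simp
  qed
  then show ?thesis using g by (auto simp: carrier_presented_group elim!: quotientE)
qed

section \<open>Gates built from square roots of -1\<close>

lemma GL_carrier_iff:
  "A \<in> carrier (GL N) \<longleftrightarrow>
    A \<in> carrier_mat N N \<and> (\<exists>B \<in> carrier_mat N N. B * A = 1\<^sub>m N \<and> A * B = 1\<^sub>m N)"
  by (auto simp: units_of_def Units_def ring_mat_def)

lemma GL_mult [simp]: "A \<otimes>\<^bsub>GL N\<^esub> B = A * B"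
  by (simp add: units_of_def ring_mat_def)

lemma GL_one [simp]: "\<one>\<^bsub>GL N\<^esub> = 1\<^sub>m N"
  by (simp add: units_of_def ring_mat_def)

lemma GL_carrierD: "A \<in> carrier (GL N) \<Longrightarrow> A \<in> carrier_mat N N"
  by (simp add: GL_carrier_iff)

text \<open>When \<open>x * x = - 1\<^sub>m N\<close>, this is the exponential of pi/4 times
  \<open>x\<close>.\<close>

definition gate :: "nat \<Rightarrow> complex mat \<Rightarrow> complex mat" where
  "gate N x = inv_sqrt2 \<cdot>\<^sub>m (x + 1\<^sub>m N)"

text \<open>These are the relations of a 2-group, extraspecial up to its centre, whose central
  involution acts as -1. Far commutation is recorded for one order of the indices only, the equation
  being symmetric.\<close>

definition clifford_gens :: "nat \<Rightarrow> nat \<Rightarrow> (nat \<Rightarrow> complex mat) \<Rightarrow> bool" where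
  "clifford_gens n N x \<longleftrightarrow>
    (\<forall>i\<in>{1..<n}. x i \<in> carrier_mat N N \<and> x i * x i = - 1\<^sub>m N) \<and>
    (\<forall>i\<in>{1..<n}. \<forall>j\<in>{1..<n}. i + 2 \<le> j \<longrightarrow> x j * x i = x i * x j) \<and>
    (\<forall>i. 1 \<le> i \<and> i + 2 \<le> n \<longrightarrow> x (i + 1) * x i = - (x i * x (i + 1)))"

lemma inv_sqrt2_mult: "inv_sqrt2 * inv_sqrt2 = 1 / 2"
  by (simp add: inv_sqrt2_def flip: of_real_mult)

lemma gate_carrier [simp]: "x \<in> carrier_mat N N \<Longrightarrow> gate N x \<in> carrier_mat N N"
  by (simp add: gate_def)

lemma smult_smult_mat: "c \<cdot>\<^sub>m (d \<cdot>\<^sub>m A) = (c * d) \<cdot>\<^sub>m (A :: complex mat)"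
  by (rule eq_matI) auto

lemma gate_mult:
  assumes "x \<in> carrier_mat N N" "y \<in> carrier_mat N N"
  shows "gate N x * gate N y = (1 / 2) \<cdot>\<^sub>m (x * y + x + y + 1\<^sub>m N)"
proof -
  have "(x + 1\<^sub>m N) * (y + 1\<^sub>m N) = x * y + y + (x + 1\<^sub>m N)"
    using assms by (simp add: add_mult_distrib_mat[where nr = N and n = N and nc = N]
        mult_add_distrib_mat[where nr = N and n = N and nc = N])
  also have "\<dots> = x * y + x + y + 1\<^sub>m N"
    using assms by (intro eq_matI) auto
  finally show ?thesis
    using assms by (simp add: gate_def mult_smult_assoc_mat[where nr = N and n = N and nc = N]
        mult_smult_distrib[where nr = N and n = N and nc = N] smult_smult_mat inv_sqrt2_mult)
qed

text \<open>The inverse is the gate of \<open>- x\<close>, since (1 + x)(1 - x) = 1 - x^2 =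
  2.\<close>

lemma gate_in_GL:
  assumes x: "x \<in> carrier_mat N N" and xx: "x * x = - 1\<^sub>m N"
  shows "gate N x \<in> carrier (GL N)"
proof -
  have "gate N x * gate N (- x) = 1\<^sub>m N" "gate N (- x) * gate N x = 1\<^sub>m N"
    using x by (auto simp: gate_mult xx intro!: eq_matI)
  then show ?thesis using x unfolding GL_carrier_iff
    by (metis gate_carrier uminus_carrier_mat)
qed

lemma gate_commute:
  assumes x: "x \<in> carrier_mat N N" and y: "y \<in> carrier_mat N N" and yx: "y * x = x * y"
  shows "gate N x * gate N y = gate N y * gate N x"
proof -
  have "x * y + x + y = x * y + y + x"
    using x y assoc_add_mat[of "x * y" N N] comm_add_mat[OF x y] by simp
  then show ?thesis using x y by (simp add: gate_mult yx)
qed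

text \<open>With \<open>z = x * y\<close>, the rules \<open>z * x = y\<close> and
  \<open>z * y = - x\<close> reduce every product to a combination of 1, x, y and z. On both sides
  all but x and y cancels, leaving (x + y) / sqrt 2.\<close>

lemma gate_braid:
  assumes x: "x \<in> carrier_mat N N" and y: "y \<in> carrier_mat N N"
    and xx: "x * x = - 1\<^sub>m N" and yy: "y * y = - 1\<^sub>m N" and yx: "y * x = - (x * y)"
  shows "gate N x * gate N y * gate N x = gate N y * gate N x * gate N y"
proof -
  define z where "z = x * y"
  have z: "z \<in> carrier_mat N N" using x y by (simp add: z_def)
  have zx: "z * x = y"
  proof -
    have "z * x = x * (y * x)" using x y by (simp add: z_def)
    also have "\<dots> = - (x * x * y)" using x y by (simp add: yx)
    also have "\<dots> = y" using y by (simp add: xx)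
    finally show ?thesis .
  qed
  have zy: "z * y = - x"
  proof -
    have "z * y = x * (y * y)" using x y by (simp add: z_def)
    then show ?thesis using x by (simp add: yy)
  qed
  have *: "((1 / 2) \<cdot>\<^sub>m A) * gate N u = (inv_sqrt2 / 2) \<cdot>\<^sub>m (A * u + A)"
    if "A \<in> carrier_mat N N" "u \<in> carrier_mat N N" for A u :: "complex mat"
    using that by (simp add: gate_def mult_smult_assoc_mat[where nr = N and n = N and nc = N]
        mult_smult_distrib[where nr = N and n = N and nc = N] smult_smult_mat
        add_smult_distrib_left_mat[of _ N N, symmetric]
        mult_add_distrib_mat[where nr = N and n = N and nc = N])
  have "(z + x + y + 1\<^sub>m N) * x = y + (- 1\<^sub>m N + (- z + x))"
    "(- z + y + x + 1\<^sub>m N) * y = x + (- 1\<^sub>m N + (z + y))"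
    using x y z by (simp_all add: add_mult_distrib_mat[where nr = N and n = N and nc = N]
        zx zy xx yy yx z_def[symmetric])
  then have "(z + x + y + 1\<^sub>m N) * x + (z + x + y + 1\<^sub>m N) =
      (- z + y + x + 1\<^sub>m N) * y + (- z + y + x + 1\<^sub>m N)"
    using x y z by (auto intro!: eq_matI)
  then show ?thesis
    using x y z by (simp add: gate_mult yx z_def[symmetric] *)
qed

text \<open>\<open>pres_lift\<close> is meaningful only after the relations have been verified on
  the generators. Doing this once for every family of gates serves all the representations
  involved.\<close>

lemma clifford_braid_rep:
  assumes x: "clifford_gens n N x" and f: "\<And>i. i \<in> {1..<n} \<Longrightarrow> f i = gate N (x i)"
  shows "representation (braid_group n) N (braid_rep N f)"
    and "\<And>i. i \<in> {1..<n} \<Longrightarrow> braid_rep N f (pres_gen {1..<n} (braid_relations n) i) = f i"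
proof -
  interpret G: group "GL N" by (rule group_GL)
  have car: "x i \<in> carrier_mat N N" and sq: "x i * x i = - 1\<^sub>m N" if "i \<in> {1..<n}" for i
    using x that by (auto simp: clifford_gens_def)
  have comm: "gate N (x i) * gate N (x j) = gate N (x j) * gate N (x i)"
    if "i \<in> {1..<n}" "j \<in> {1..<n}" "i + 2 \<le> j" for i j
    using x that by (intro gate_commute car) (auto simp: clifford_gens_def)
  have braid: "gate N (x i) * gate N (x (i + 1)) * gate N (x i) =
      gate N (x (i + 1)) * gate N (x i) * gate N (x (i + 1))" if "1 \<le> i" "i + 2 \<le> n" for i
    using x that by (intro gate_braid car sq) (auto simp: clifford_gens_def)
  have closed: "gate N (x i) \<in> carrier (GL N)" if "i \<in> {1..<n}" for i
    by (rule gate_in_GL[OF car sq]) (use that in auto)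
  then have fS: "f \<in> {1..<n} \<rightarrow> carrier (GL N)" using f by auto
  have gm: "gate N (x i) \<in> carrier_mat N N" if "i \<in> {1..<n}" for i using car that by simp
  have R: "\<forall>(l, r) \<in> braid_relations n. word_eval (GL N) f l = word_eval (GL N) f r"
  proof (intro ballI)
    fix x assume "x \<in> braid_relations n"
    then consider (far) i j where "x = ([(i, True), (j, True)], [(j, True), (i, True)])"
        "1 \<le> i" "i < n" "1 \<le> j" "j < n" "i + 2 \<le> j \<or> j + 2 \<le> i"
      | (near) i where "x = ([(i, True), (i + 1, True), (i, True)], [(i + 1, True), (i, True), (i + 1, True)])"
        "1 \<le> i" "i + 2 \<le> n"
      unfolding braid_relations_def Un_iff mem_Collect_eq by blast
    then show "case x of (l, r) \<Rightarrow> word_eval (GL N) f l = word_eval (GL N) f r"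
    proof cases
      case (far i j)
      then have "f i * f j = f j * f i" using comm[of i j] comm[of j i] f[of i] f[of j] by auto
      then show ?thesis using far gm[of i] gm[of j] f[of i] f[of j] by simp
    next
      case (near i)
      then have "f i * f (i + 1) * f i = f (i + 1) * f i * f (i + 1)"
        using braid[of i] f[of i] f[of "i + 1"] by simp
      moreover have "f i \<in> carrier_mat N N" "f (i + 1) \<in> carrier_mat N N"
        using near gm[of i] gm[of "i + 1"] f[of i] f[of "i + 1"] by simp_all
      ultimately show ?thesis using near(1) by simp
    qed
  qed
  show "representation (braid_group n) N (braid_rep N f)"
    unfolding representation_def braid_group_def braid_rep_def by (rule G.pres_lift_hom[OF fS R])
  show "braid_rep N f (pres_gen {1..<n} (braid_relations n) i) = f i" if "i \<in> {1..<n}" for i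
    unfolding braid_rep_def by (rule G.pres_lift_gen[OF fS R that])
qed

lemma isomorphic_repsI:
  assumes "representation (braid_group n) N \<rho>" "representation (braid_group n) N \<rho>'"
    and "P \<in> carrier (GL N)"
    and "\<And>i. i \<in> {1..<n} \<Longrightarrow> P * \<rho> (pres_gen {1..<n} (braid_relations n) i) =
      \<rho>' (pres_gen {1..<n} (braid_relations n) i) * P"
  shows "isomorphic_reps (braid_group n) N \<rho> \<rho>'"
  unfolding isomorphic_reps_def
proof (intro conjI bexI ballI)
  fix g assume "g \<in> carrier (braid_group n)"
  then show "P * \<rho> g = \<rho>' g * P"
    using presented_group_hom_intertwine[OF group_GL, of \<rho> "{1..<n}" "braid_relations n" N \<rho>' P g] assms
    by (simp add: representation_def braid_group_def)
qed (use assms in auto)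

section \<open>Trivial tensor factors and direct sums of representations\<close>

lemma kron_one_in_GL:
  assumes "A \<in> carrier (GL N)"
  shows "1\<^sub>m m \<otimes>\<^sub>k A \<in> carrier (GL (m * N))"
proof -
  obtain B where B: "B \<in> carrier_mat N N" "B * A = 1\<^sub>m N" "A * B = 1\<^sub>m N"
    using assms by (auto simp: GL_carrier_iff)
  have A: "A \<in> carrier_mat N N" by (rule GL_carrierD[OF assms])
  have "(1\<^sub>m m \<otimes>\<^sub>k B) * (1\<^sub>m m \<otimes>\<^sub>k A) = 1\<^sub>m (m * N)" "(1\<^sub>m m \<otimes>\<^sub>k A) * (1\<^sub>m m \<otimes>\<^sub>k B) = 1\<^sub>m (m * N)"
    using A B by (simp_all add: kron_mult[of _ m m _ N N _ m _ N] kron_one_one)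
  then show ?thesis using A B(1) unfolding GL_carrier_iff by (metis kron_carrier one_carrier_mat)
qed

lemma representation_tensor_trivial:
  assumes "representation G N \<rho>"
  shows "representation G (m * N) (tensor_rep (trivial_rep m) \<rho>)"
  unfolding representation_def
proof (rule homI)
  have \<rho>: "\<rho> \<in> hom G (GL N)" using assms by (simp add: representation_def)
  show "tensor_rep (trivial_rep m) \<rho> g \<in> carrier (GL (m * N))" if "g \<in> carrier G" for g
    using hom_in_carrier[OF \<rho> that] by (simp add: tensor_rep_def trivial_rep_def kron_one_in_GL)
  show "tensor_rep (trivial_rep m) \<rho> (g \<otimes>\<^bsub>G\<^esub> h) =
      tensor_rep (trivial_rep m) \<rho> g \<otimes>\<^bsub>GL (m * N)\<^esub> tensor_rep (trivial_rep m) \<rho> h"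
    if "g \<in> carrier G" "h \<in> carrier G" for g h
    using hom_mult[OF \<rho> that] GL_carrierD[OF hom_in_carrier[OF \<rho> that(1)]]
      GL_carrierD[OF hom_in_carrier[OF \<rho> that(2)]]
    by (simp add: tensor_rep_def trivial_rep_def kron_mult[of _ m m _ N N _ m _ N])
qed

lemma diag_block_mat_two:
  assumes "A \<in> carrier_mat a a" "B \<in> carrier_mat b b"
  shows "diag_block_mat [A, B] = four_block_mat A (0\<^sub>m a b) (0\<^sub>m b a) B"
  using assms by (auto simp: Let_def intro!: eq_matI)

lemma diag_block_mat_two_mult:
  assumes "A \<in> carrier_mat a a" "B \<in> carrier_mat b b" "C \<in> carrier_mat a a" "D \<in> carrier_mat b b"
  shows "diag_block_mat [A, B] * diag_block_mat [C, D] = diag_block_mat [A * C, B * D]"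
  using assms unfolding diag_block_mat_two[OF assms(1,2)] diag_block_mat_two[OF assms(3,4)]
  by (subst diag_block_mat_two[of _ a _ b])
    (simp_all add: mult_four_block_mat[of _ a a _ b _ b _ _ a _ b])

lemma diag_block_mat_two_in_GL:
  assumes "A \<in> carrier (GL a)" "B \<in> carrier (GL b)"
  shows "diag_block_mat [A, B] \<in> carrier (GL (a + b))"
proof -
  obtain A' where A': "A' \<in> carrier_mat a a" "A' * A = 1\<^sub>m a" "A * A' = 1\<^sub>m a"
    using assms by (auto simp: GL_carrier_iff)
  obtain B' where B': "B' \<in> carrier_mat b b" "B' * B = 1\<^sub>m b" "B * B' = 1\<^sub>m b"
    using assms by (auto simp: GL_carrier_iff)
  have car: "A \<in> carrier_mat a a" "B \<in> carrier_mat b b" using assms by (auto dest: GL_carrierD)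
  have one: "diag_block_mat [1\<^sub>m a, 1\<^sub>m b] = (1\<^sub>m (a + b) :: complex mat)"
    by (subst diag_block_mat_two) (auto intro!: eq_matI)
  have "diag_block_mat [A', B'] * diag_block_mat [A, B] = 1\<^sub>m (a + b)"
    "diag_block_mat [A, B] * diag_block_mat [A', B'] = 1\<^sub>m (a + b)"
    using A' B' car by (simp_all only: diag_block_mat_two_mult one)
  moreover have "diag_block_mat [A', B'] \<in> carrier_mat (a + b) (a + b)"
    "diag_block_mat [A, B] \<in> carrier_mat (a + b) (a + b)"
    using A' B' car by (auto simp: diag_block_mat_two)
  ultimately show ?thesis unfolding GL_carrier_iff by blast
qed

lemma representation_direct_sum:
  assumes "representation G a \<rho>" "representation G b \<rho>'"
  shows "representation G (a + b) (direct_sum_rep \<rho> \<rho>')"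
  unfolding representation_def
proof (rule homI)
  have \<rho>: "\<rho> \<in> hom G (GL a)" and \<rho>': "\<rho>' \<in> hom G (GL b)"
    using assms by (simp_all add: representation_def)
  show "direct_sum_rep \<rho> \<rho>' g \<in> carrier (GL (a + b))" if "g \<in> carrier G" for g
    unfolding direct_sum_rep_def
    by (rule diag_block_mat_two_in_GL[OF hom_in_carrier[OF \<rho> that] hom_in_carrier[OF \<rho>' that]])
  show "direct_sum_rep \<rho> \<rho>' (g \<otimes>\<^bsub>G\<^esub> h) =
      direct_sum_rep \<rho> \<rho>' g \<otimes>\<^bsub>GL (a + b)\<^esub> direct_sum_rep \<rho> \<rho>' h"
    if "g \<in> carrier G" "h \<in> carrier G" for g h
    unfolding direct_sum_rep_def hom_mult[OF \<rho> that] hom_mult[OF \<rho>' that] GL_mult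
    by (rule diag_block_mat_two_mult[symmetric])
      (use that hom_in_carrier[OF \<rho>] hom_in_carrier[OF \<rho>'] GL_carrierD in blast)+
qed

section \<open>The generators as monomial matrices\<close>

lemma bit_Suc_0_0 [simp]: "bit (Suc 0) 0"
  by (simp add: bit_0)

lemma one_kron [simp]: "1\<^sub>m (Suc 0) \<otimes>\<^sub>k A = A"
  by (rule eq_matI) (auto simp: kron_def)

lemma kron_one [simp]: "A \<otimes>\<^sub>k 1\<^sub>m (Suc 0) = A"
  by (rule eq_matI) (auto simp: kron_def)

text \<open>The left identity factor occupies the lowest \<open>a\<close> bits, so the middle factor
  acts on the bits \<open>a\<close> to \<open>a + b - 1\<close>.\<close>

lemma kron_pauli_embed:
  assumes "\<mu> < 2 ^ b"
  shows "I2pow a \<otimes>\<^sub>k pauli b \<mu> \<phi> \<otimes>\<^sub>k I2pow c =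
    pauli (a + b + c) (push_bit a \<mu>) (\<lambda>q. \<phi> (take_bit b (drop_bit a q)))"
proof -
  have "push_bit a \<mu> < 2 ^ (a + b)" using assms by (simp add: push_bit_eq_mult power_add)
  then show ?thesis
    by (simp add: I2pow_eq one_eq_pauli pauli_kron drop_bit_take_bit)
qed

text \<open>Tensoring with identities is linear and preserves the identity matrix, hence passes
  through the formation of gates.\<close>

lemma kron_gate_embed:
  assumes "x \<in> carrier_mat N N"
  shows "1\<^sub>m a \<otimes>\<^sub>k gate N x \<otimes>\<^sub>k 1\<^sub>m c = gate (a * N * c) (1\<^sub>m a \<otimes>\<^sub>k x \<otimes>\<^sub>k 1\<^sub>m c)"
  using assms by (simp add: gate_def kron_smult_right kron_smult_left kron_add_right[of _ N N]
      kron_add_left[of _ "a * N" "a * N"] kron_one_one)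

lemma kron_gate_pauli_embed:
  assumes "\<mu> < 2 ^ b" "n = a + b + c"
  shows "I2pow a \<otimes>\<^sub>k gate (2 ^ b) (pauli b \<mu> \<phi>) \<otimes>\<^sub>k I2pow c =
    gate (2 ^ n) (pauli n (push_bit a \<mu>) (\<lambda>q. \<phi> (take_bit b (drop_bit a q))))"
  using kron_pauli_embed[OF assms(1), of a \<phi> c] assms(2)
  by (simp add: I2pow_eq kron_gate_embed power_add)

definition sg :: "bool \<Rightarrow> complex" where
  "sg b = (if b then -1 else 1)"

lemma sg_simps [simp]: "sg True = -1" "sg False = 1" "sg (\<not> b) = - sg b" "sg b * sg b = 1"
  by (simp_all add: sg_def)

text \<open>Off its diagonal \<open>R_mat\<close> is antidiagonal, that is, it flips both bits (mask
  3). The sign of an entry depends on the low bit of its column.\<close>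

lemma R_mat_eq: "R_mat = gate (2 ^ 2) (pauli 2 3 (\<lambda>q. - sg (bit q 0)))"
proof (rule eq_matI)
  fix i j assume "i < dim_row (gate (2 ^ 2) (pauli 2 3 (\<lambda>q. - sg (bit q 0))))"
    "j < dim_col (gate (2 ^ 2) (pauli 2 3 (\<lambda>q. - sg (bit q 0))))"
  then have "i \<in> {0, 1, 2, 3}" "j \<in> {0, 1, 2, 3}" by (auto simp: gate_def)
  then show "R_mat $$ (i, j) = gate (2 ^ 2) (pauli 2 3 (\<lambda>q. - sg (bit q 0))) $$ (i, j)"
    by (auto simp: R_mat_def gate_def pauli_def mat_of_rows_list_def)
qed (simp_all add: R_mat_def gate_def mat_of_rows_list_def)

text \<open>The diagonal entries \<open>zeta\<close> and \<open>cnj zeta\<close> are (1 + \<i>) /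
  sqrt 2 and (1 - \<i>) / sqrt 2; the parity of the two bits decides between them.\<close>

lemma D_mat_eq: "D_mat = gate (2 ^ 2) (pauli 2 0 (\<lambda>q. \<i> * sg (bit q 0) * sg (bit q 1)))"
  (is "_ = ?g")
proof (rule eq_matI)
  fix i j assume "i < dim_row ?g" "j < dim_col ?g"
  then have "i \<in> {0, 1, 2, 3}" "j \<in> {0, 1, 2, 3}" by (auto simp: gate_def)
  then show "D_mat $$ (i, j) = ?g $$ (i, j)"
    by (auto simp: D_mat_def gate_def pauli_def mat_of_rows_list_def zeta_def inv_sqrt2_def algebra_simps)
qed (simp_all add: D_mat_def gate_def mat_of_rows_list_def)

lemma d_mat_eq: "d_mat = gate (2 ^ 1) (pauli 1 0 (\<lambda>q. \<i> * sg (bit q 0)))" (is "_ = ?g")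
proof (rule eq_matI)
  fix i j assume "i < dim_row ?g" "j < dim_col ?g"
  then have "i \<in> {0, 1}" "j \<in> {0, 1}" by (auto simp: gate_def)
  then show "d_mat $$ (i, j) = ?g $$ (i, j)"
    by (auto simp: d_mat_def gate_def pauli_def mat_of_rows_list_def zeta_def inv_sqrt2_def algebra_simps)
qed (simp_all add: d_mat_def gate_def mat_of_rows_list_def)

lemma M_mat_eq: "M_mat = gate (2 ^ 1) (pauli 1 1 (\<lambda>q. - sg (bit q 0)))" (is "_ = ?g")
proof (rule eq_matI)
  fix i j assume "i < dim_row ?g" "j < dim_col ?g"
  then have "i \<in> {0, 1}" "j \<in> {0, 1}" by (auto simp: gate_def)
  then show "M_mat $$ (i, j) = ?g $$ (i, j)"
    by (auto simp: M_mat_def gate_def pauli_def mat_of_rows_list_def)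
qed (simp_all add: M_mat_def gate_def mat_of_rows_list_def)

lemma s_mat_eq: "s_mat = pauli 1 1 (\<lambda>q. - sg (bit q 0))" (is "_ = ?g")
proof (rule eq_matI)
  fix i j assume "i < dim_row ?g" "j < dim_col ?g"
  then have "i \<in> {0, 1}" "j \<in> {0, 1}" by auto
  then show "s_mat $$ (i, j) = ?g $$ (i, j)"
    by (auto simp: s_mat_def pauli_def mat_of_rows_list_def)
qed (simp_all add: s_mat_def mat_of_rows_list_def)

lemma sigma_z_eq: "sigma_z = pauli 1 0 (\<lambda>q. sg (bit q 0))" (is "_ = ?g")
proof (rule eq_matI)
  fix i j assume "i < dim_row ?g" "j < dim_col ?g"
  then have "i \<in> {0, 1}" "j \<in> {0, 1}" by auto
  then show "sigma_z $$ (i, j) = ?g $$ (i, j)"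
    by (auto simp: sigma_z_def pauli_def mat_of_rows_list_def)
qed (simp_all add: sigma_z_def mat_of_rows_list_def)

text \<open>Tensor factors are numbered from 1 and bits from 0, so generator \<open>i\<close> flips
  the bits \<open>i - 1\<close> and \<open>i\<close>.\<close>

definition pi_mask :: "nat \<Rightarrow> nat" where
  "pi_mask i = xor (2 ^ (i - 1)) (2 ^ i)"

definition pi_phase :: "nat \<Rightarrow> nat \<Rightarrow> complex" where
  "pi_phase i q = - sg (bit q (i - 1))"

definition rho_mask :: "nat \<Rightarrow> nat" where
  "rho_mask j = (if even j then 2 ^ (j div 2 - 1) else 0)"

text \<open>The bit \<open>u\<close> preceding position \<open>l\<close> counts as
  \<open>False\<close> when \<open>l = 0\<close>. This makes the first generator, given by
  \<open>d_mat\<close>, the boundary case of the formula for \<open>D_mat\<close>.\<close>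

definition rho_phase :: "nat \<Rightarrow> nat \<Rightarrow> complex" where
  "rho_phase j q = (let l = j div 2; u = l \<noteq> 0 \<and> bit q (l - 1) in
    if even j then - sg u else \<i> * sg (bit q l) * sg u)"

lemma push_bit_3: "push_bit a 3 = xor (2 ^ a) (2 ^ Suc a :: nat)"
proof -
  have "(3 :: nat) = xor 1 2" by simp
  then show ?thesis by (simp only: push_bit_xor) (simp add: push_bit_eq_mult)
qed

lemma pi_gen_eq:
  assumes "i \<in> {1..<n}"
  shows "pi_gen n i = gate (2 ^ n) (pauli n (pi_mask i) (pi_phase i))"
proof -
  have "pi_gen n i = gate (2 ^ n) (pauli n (push_bit (i - 1) 3)
      (\<lambda>q. - sg (bit (take_bit 2 (drop_bit (i - 1) q)) 0)))"
    unfolding pi_gen_def R_mat_eq by (rule kron_gate_pauli_embed) (use assms in auto)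
  also have "\<dots> = gate (2 ^ n) (pauli n (pi_mask i) (pi_phase i))"
    using assms by (intro arg_cong[where f = "gate (2 ^ n)"] pauli_cong)
      (simp_all add: pi_mask_def pi_phase_def push_bit_3 bit_take_bit_iff bit_drop_bit_eq even_drop_bit_iff_not_bit)
  finally show ?thesis .
qed

text \<open>Writing \<open>Suc l\<close> makes \<open>l\<close> the zero-based position of the
  lowest bit on which generator \<open>j\<close> acts.\<close>

lemma odd_even_cases:
  fixes j :: nat
  assumes "1 \<le> j"
  obtains "j = 1" | l where "j = 2 * Suc l" | l where "j = 2 * Suc l + 1"
proof -
  have "j = 2 * (j div 2) \<or> j = 2 * (j div 2) + 1" by presburger
  then show thesis using that assms by (cases "j div 2") (auto simp del: mult_Suc_right)
qed

lemma rho_gen_eq: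
  assumes "1 \<le> j" "j \<le> 2 * k"
  shows "rho_gen k j = gate (2 ^ k) (pauli k (rho_mask j) (rho_phase j))"
proof -
  from assms(1) show ?thesis
  proof (cases rule: odd_even_cases)
    case 1
    have "rho_gen k j = I2pow 0 \<otimes>\<^sub>k gate (2 ^ 1) (pauli 1 0 (\<lambda>q. \<i> * sg (bit q 0))) \<otimes>\<^sub>k I2pow (k - 1)"
      using 1 by (simp add: rho_gen_def d_mat_eq)
    also have "\<dots> = gate (2 ^ k) (pauli k (push_bit 0 0)
        (\<lambda>q. \<i> * sg (bit (take_bit 1 (drop_bit 0 q)) 0)))"
      by (rule kron_gate_pauli_embed) (use assms in auto)
    also have "\<dots> = gate (2 ^ k) (pauli k (rho_mask j) (rho_phase j))"
      using 1 by (intro arg_cong[where f = "gate (2 ^ k)"] pauli_cong)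
        (simp_all add: rho_mask_def rho_phase_def bit_take_bit_iff bit_0)
    finally show ?thesis .
  next
    case (2 l)
    have "rho_gen k j = I2pow l \<otimes>\<^sub>k gate (2 ^ 1) (pauli 1 1 (\<lambda>q. - sg (bit q 0))) \<otimes>\<^sub>k I2pow (k - Suc l)"
      using 2 by (simp add: rho_gen_def M_mat_eq)
    also have "\<dots> = gate (2 ^ k) (pauli k (push_bit l 1)
        (\<lambda>q. - sg (bit (take_bit 1 (drop_bit l q)) 0)))"
      by (rule kron_gate_pauli_embed) (use assms 2 in auto)
    also have "\<dots> = gate (2 ^ k) (pauli k (rho_mask j) (rho_phase j))"
      using 2 by (intro arg_cong[where f = "gate (2 ^ k)"] pauli_cong)
        (simp_all add: rho_mask_def rho_phase_def bit_take_bit_iff bit_drop_bit_eq even_drop_bit_iff_not_bit push_bit_eq_mult)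
    finally show ?thesis .
  next
    case (3 l)
    have "j div 2 = Suc l" using 3 by simp
    then have "rho_gen k j = I2pow l \<otimes>\<^sub>k gate (2 ^ 2) (pauli 2 0 (\<lambda>q. \<i> * sg (bit q 0) * sg (bit q 1)))
        \<otimes>\<^sub>k I2pow (k - Suc l - 1)"
      using 3 by (simp add: rho_gen_def D_mat_eq)
    also have "\<dots> = gate (2 ^ k) (pauli k (push_bit l 0)
        (\<lambda>q. \<i> * sg (bit (take_bit 2 (drop_bit l q)) 0) * sg (bit (take_bit 2 (drop_bit l q)) 1)))"
      by (rule kron_gate_pauli_embed) (use assms 3 in auto)
    also have "\<dots> = gate (2 ^ k) (pauli k (rho_mask j) (rho_phase j))"
      using 3 \<open>j div 2 = Suc l\<close> by (intro arg_cong[where f = "gate (2 ^ k)"] pauli_cong)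
        (simp_all add: rho_mask_def rho_phase_def bit_take_bit_iff bit_drop_bit_eq even_drop_bit_iff_not_bit)
    finally show ?thesis .
  qed
qed

text \<open>The sign \<open>\<epsilon>\<close> is the value of an additional top bit of the index.\<close>

lemma lambda_x_eq:
  assumes "1 \<le> j" "j < 2 * k" and t: "t = (if b then 2 ^ (k - 1) else 0)"
  shows "lambda_x (sg b) k j = pauli (k - 1) (rho_mask j) (\<lambda>q. rho_phase j (xor q t))"
proof (cases "k = 1")
  case True
  then have "j = 1" using assms by simp
  \<comment> \<open>With no bits left for \<open>q\<close>, the phase reads bit 0, which is the
    additional top bit itself.\<close>
  then show ?thesis using True t
    by (auto simp: lambda_x_def one_eq_pauli[of 0, simplified] smult_pauli rho_mask_def rho_phase_def
      intro!: pauli_cong)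
next
  case False
  then obtain k' where k: "k = Suc (Suc k')" using assms by (cases k rule: nat.exhaust; cases "k - 1") auto
  consider "j = 1" | l where "j = 2 * Suc l" | l where "j = 2 * Suc l + 1" "l < k'" | "j = 2 * Suc k' + 1"
  proof -
    from assms(1) show thesis
    proof (cases rule: odd_even_cases)
      case (3 l)
      then have "l < k' \<or> l = k'" using assms(2) k by presburger
      then show thesis using 3 that by blast
    qed (use that in blast)+
  qed
  then show ?thesis
  proof cases
    case 1
    have "lambda_x (sg b) k j = \<i> \<cdot>\<^sub>m (I2pow 0 \<otimes>\<^sub>k pauli 1 0 (\<lambda>q. sg (bit q 0)) \<otimes>\<^sub>k I2pow k')"
      using 1 k by (simp add: lambda_x_def sigma_z_eq)
    also have "\<dots> = pauli (k - 1) (rho_mask j) (\<lambda>q. rho_phase j (xor q t))"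
      using 1 k t by (subst kron_pauli_embed)
        (auto simp: smult_pauli rho_mask_def rho_phase_def bit_take_bit_iff bit_xor_iff bit_0 intro!: pauli_cong)
    finally show ?thesis .
  next
    case (2 l)
    \<comment> \<open>That is, \<open>l\<close> differs from \<open>Suc k'\<close>, the only bit
      that \<open>t\<close> can change.\<close>
    have l: "l = 0 \<or> l - Suc 0 \<noteq> k'" using 2 k assms(2) by presburger
    have "lambda_x (sg b) k j = I2pow l \<otimes>\<^sub>k pauli 1 1 (\<lambda>q. - sg (bit q 0)) \<otimes>\<^sub>k I2pow (k' - l)"
      using 2 k by (simp add: lambda_x_def s_mat_eq)
    also have "\<dots> = pauli (k - 1) (rho_mask j) (\<lambda>q. rho_phase j (xor q t))"
      using 2 k t l assms(2) by (subst kron_pauli_embed)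
        (auto simp: rho_mask_def rho_phase_def bit_take_bit_iff bit_drop_bit_eq even_drop_bit_iff_not_bit bit_xor_iff bit_exp_iff bit_double_iff
          push_bit_eq_mult intro!: pauli_cong)
    finally show ?thesis .
  next
    case (3 l)
    have l: "j div 2 = Suc l" "l = 0 \<or> l - Suc 0 \<noteq> k'" using 3 by auto
    have zz: "sigma_z \<otimes>\<^sub>k sigma_z = pauli (1 + 1) 0 (\<lambda>q. sg (bit q 0) * sg (bit q 1))"
      unfolding sigma_z_eq by (subst pauli_kron)
        (auto simp: bit_take_bit_iff bit_drop_bit_eq even_drop_bit_iff_not_bit bit_0 intro!: pauli_cong)
    have "lambda_x (sg b) k j = \<i> \<cdot>\<^sub>m (I2pow l \<otimes>\<^sub>k sigma_z \<otimes>\<^sub>k sigma_z \<otimes>\<^sub>k I2pow (k' - Suc l))"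
      using 3 k l by (simp add: lambda_x_def)
    also have "I2pow l \<otimes>\<^sub>k sigma_z \<otimes>\<^sub>k sigma_z = I2pow l \<otimes>\<^sub>k (sigma_z \<otimes>\<^sub>k sigma_z)"
      by (simp add: I2pow_eq one_eq_pauli sigma_z_eq pauli_kron drop_bit_take_bit)
    also have "\<i> \<cdot>\<^sub>m (I2pow l \<otimes>\<^sub>k (sigma_z \<otimes>\<^sub>k sigma_z) \<otimes>\<^sub>k I2pow (k' - Suc l)) =
        pauli (k - 1) (rho_mask j) (\<lambda>q. rho_phase j (xor q t))"
      unfolding zz one_add_one using 3 k t l by (subst kron_pauli_embed)
        (auto simp: smult_pauli rho_mask_def rho_phase_def bit_take_bit_iff bit_drop_bit_eq even_drop_bit_iff_not_bit bit_xor_iff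
          bit_exp_iff bit_double_iff intro!: pauli_cong)
    finally show ?thesis .
  next
    case 4
    \<comment> \<open>In this last case the phase reads bit \<open>Suc k'\<close>, which is zero in
      \<open>q\<close> and equals \<open>b\<close> after the xor with \<open>t\<close>. It thereby
      supplies the sign \<open>sg b\<close>.\<close>
    have top: "\<not> bit q (Suc k')" if "q < 2 ^ Suc k'" for q :: nat
      using not_bit_high[OF that] by simp
    have top0: "\<not> bit q (Suc 0)" if "q < 2" for q :: nat
      using not_bit_high[of q 1 "Suc 0"] that by simp
    have l: "j div 2 = Suc k'" "k' = 0 \<or> k' - Suc 0 \<noteq> k'" using 4 by auto
    have "lambda_x (sg b) k j = (sg b * \<i>) \<cdot>\<^sub>m (I2pow k' \<otimes>\<^sub>k pauli 1 0 (\<lambda>q. sg (bit q 0)) \<otimes>\<^sub>k I2pow 0)"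
      using 4 k l by (simp add: lambda_x_def sigma_z_eq)
    also have "\<dots> = pauli (k - 1) (rho_mask j) (\<lambda>q. rho_phase j (xor q t))"
      using 4 k t l by (subst kron_pauli_embed)
        (auto simp: smult_pauli rho_mask_def rho_phase_def bit_take_bit_iff bit_drop_bit_eq even_drop_bit_iff_not_bit bit_xor_iff
          bit_exp_iff bit_double_iff top top0 intro!: pauli_cong)
    finally show ?thesis .
  qed
qed

section \<open>Clifford relations\<close>

text \<open>The mask of a product is the xor of the masks, which is symmetric and vanishes on
  squares; only the phases have to be compared.\<close>

lemma pauli_clifford_gens:
  assumes mask: "\<And>i. i \<in> {1..<n} \<Longrightarrow> \<mu> i < 2 ^ a"
    and sq: "\<And>i q. i \<in> {1..<n} \<Longrightarrow> \<phi> i (xor q (\<mu> i)) * \<phi> i q = -1"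
    and far: "\<And>i j q. 1 \<le> i \<Longrightarrow> i + 2 \<le> j \<Longrightarrow> j < n \<Longrightarrow>
      \<phi> j (xor q (\<mu> i)) * \<phi> i q = \<phi> i (xor q (\<mu> j)) * \<phi> j q"
    and near: "\<And>i q. 1 \<le> i \<Longrightarrow> i + 2 \<le> n \<Longrightarrow>
      \<phi> (i + 1) (xor q (\<mu> i)) * \<phi> i q = - (\<phi> i (xor q (\<mu> (i + 1))) * \<phi> (i + 1) q)"
  shows "clifford_gens n (2 ^ a) (\<lambda>i. pauli a (\<mu> i) (\<phi> i))"
  unfolding clifford_gens_def
proof (intro conjI ballI allI impI)
  show "pauli a (\<mu> i) (\<phi> i) * pauli a (\<mu> i) (\<phi> i) = - 1\<^sub>m (2 ^ a)" if "i \<in> {1..<n}" for i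
    unfolding pauli_mult[OF mask[OF that] mask[OF that]] sq[OF that] by (simp add: one_eq_pauli uminus_pauli)
  show "pauli a (\<mu> j) (\<phi> j) * pauli a (\<mu> i) (\<phi> i) = pauli a (\<mu> i) (\<phi> i) * pauli a (\<mu> j) (\<phi> j)"
    if "i \<in> {1..<n}" "j \<in> {1..<n}" "i + 2 \<le> j" for i j
    unfolding pauli_mult[OF mask[OF that(1)] mask[OF that(2)]] pauli_mult[OF mask[OF that(2)] mask[OF that(1)]]
    using that by (intro pauli_cong far) (auto simp: xor.commute)
  show "pauli a (\<mu> (i + 1)) (\<phi> (i + 1)) * pauli a (\<mu> i) (\<phi> i) =
      - (pauli a (\<mu> i) (\<phi> i) * pauli a (\<mu> (i + 1)) (\<phi> (i + 1)))" if "1 \<le> i \<and> i + 2 \<le> n" for i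
  proof -
    have i: "i \<in> {1..<n}" "i + 1 \<in> {1..<n}" using that by auto
    show ?thesis
      unfolding pauli_mult[OF mask[OF i(1)] mask[OF i(2)]] pauli_mult[OF mask[OF i(2)] mask[OF i(1)]] uminus_pauli
      using that by (intro pauli_cong near) (auto simp: xor.commute)
  qed
qed simp

lemma bit_pi_mask: "1 \<le> i \<Longrightarrow> bit (pi_mask i) l \<longleftrightarrow> l = i \<or> Suc l = i"
  by (auto simp: pi_mask_def bit_xor_iff bit_exp_iff)

lemma pi_mask_less: "i \<in> {1..<n} \<Longrightarrow> pi_mask i < 2 ^ n"
  unfolding pi_mask_def by (intro xor_less_two_power power_strict_increasing) auto

text \<open>The phase of generator \<open>j\<close> reads bit \<open>j - 1\<close>, and generator
  \<open>i\<close> flips the bits \<open>i - 1\<close> and \<open>i\<close>. For neighbours only one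
  of the two phases is affected, hence they anticommute.\<close>

lemma pi_phase_xor:
  "1 \<le> i \<Longrightarrow> 1 \<le> j \<Longrightarrow>
    pi_phase j (xor q (pi_mask i)) = (if j = i \<or> j = i + 1 then - pi_phase j q else pi_phase j q)"
  by (cases j) (auto simp: pi_phase_def bit_xor_iff bit_pi_mask)

lemma clifford_gens_pi: "clifford_gens n (2 ^ n) (\<lambda>i. pauli n (pi_mask i) (pi_phase i))"
proof (rule pauli_clifford_gens)
  show "pi_phase i (xor q (pi_mask i)) * pi_phase i q = -1" if "i \<in> {1..<n}" for i q
    using that by (simp add: pi_phase_xor) (simp add: pi_phase_def)
qed (auto simp: pi_mask_less pi_phase_xor)

lemma rho_mask_less: "1 \<le> j \<Longrightarrow> j \<le> 2 * k \<Longrightarrow> rho_mask j < 2 ^ k"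
  by (auto simp: rho_mask_def elim!: evenE)

lemma rho_mask_less_pred: "1 \<le> j \<Longrightarrow> j < 2 * k \<Longrightarrow> rho_mask j < 2 ^ (k - 1)"
  using rho_mask_less[of j "k - 1"] by (cases "even j") (auto simp: rho_mask_def elim!: evenE)

text \<open>Odd generators flip nothing. An even generator \<open>2 * Suc e\<close> flips bit
  \<open>e\<close>, which is read once by its own phase and by those of its two neighbours, and by
  no other.\<close>

lemma rho_phase_xor:
  assumes "1 \<le> i" "1 \<le> j"
  shows "rho_phase j (xor q (rho_mask i)) =
    (if even i \<and> i \<le> j + 1 \<and> j \<le> i + 1 then - rho_phase j q else rho_phase j q)"
proof (cases "even i")
  case True
  obtain e where e: "i = 2 * Suc e"
    by (rule odd_even_cases[OF assms(1)]) (use True in auto)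
  from assms(2) show ?thesis
  proof (cases rule: odd_even_cases)
    case (3 l)
    have "even i \<and> i \<le> j + 1 \<and> j \<le> i + 1 \<longleftrightarrow> e = l \<or> e = Suc l"
      unfolding e 3 by presburger
    moreover have "j div 2 = Suc l" using 3 by simp
    ultimately show ?thesis
      using 3 by (auto simp: e rho_phase_def rho_mask_def bit_xor_iff bit_exp_iff Let_def)
  qed (auto simp: e rho_phase_def rho_mask_def bit_xor_iff bit_exp_iff Let_def)
qed (simp add: rho_mask_def)

lemma rho_phase_square: "rho_phase j q * rho_phase j q = (if even j then 1 else -1)"
  by (simp add: rho_phase_def Let_def sg_def)

text \<open>The shift by \<open>t\<close> commutes with all masks, so it leaves the relations
  intact. It is carried along to treat \<open>V1_rep\<close> and both signs of
  \<open>lambda_gen\<close> together.\<close>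

lemma rho_clifford_conditions:
  fixes t :: nat
  defines "\<phi> \<equiv> \<lambda>j q. rho_phase j (xor q t)"
  shows "1 \<le> i \<Longrightarrow> \<phi> i (xor q (rho_mask i)) * \<phi> i q = -1"
    and "1 \<le> i \<Longrightarrow> i + 2 \<le> j \<Longrightarrow> \<phi> j (xor q (rho_mask i)) * \<phi> i q = \<phi> i (xor q (rho_mask j)) * \<phi> j q"
    and "1 \<le> i \<Longrightarrow> \<phi> (i + 1) (xor q (rho_mask i)) * \<phi> i q =
      - (\<phi> i (xor q (rho_mask (i + 1))) * \<phi> (i + 1) q)"
proof -
  have swap: "xor (xor q \<mu>) t = xor (xor q t) \<mu>" for \<mu> by (simp add: ac_simps)
  show "1 \<le> i \<Longrightarrow> \<phi> i (xor q (rho_mask i)) * \<phi> i q = -1"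
    unfolding \<phi>_def swap by (simp add: rho_phase_xor rho_phase_square)
  show "1 \<le> i \<Longrightarrow> i + 2 \<le> j \<Longrightarrow> \<phi> j (xor q (rho_mask i)) * \<phi> i q = \<phi> i (xor q (rho_mask j)) * \<phi> j q"
    unfolding \<phi>_def swap by (simp add: rho_phase_xor)
  show "1 \<le> i \<Longrightarrow> \<phi> (i + 1) (xor q (rho_mask i)) * \<phi> i q =
      - (\<phi> i (xor q (rho_mask (i + 1))) * \<phi> (i + 1) q)"
    unfolding \<phi>_def swap by (subst (1 2) rho_phase_xor) auto
qed

lemma clifford_gens_rho:
  assumes "n \<le> 2 * k + 1"
  shows "clifford_gens n (2 ^ k) (\<lambda>i. pauli k (rho_mask i) (rho_phase i))"
  using assms
  by (intro pauli_clifford_gens rho_mask_less rho_clifford_conditions[where t = 0, unfolded xor.right_neutral]) auto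

lemma clifford_gens_lambda:
  assumes "n \<le> 2 * k"
  shows "clifford_gens n (2 ^ (k - 1)) (\<lambda>i. pauli (k - 1) (rho_mask i) (\<lambda>q. rho_phase i (xor q t)))"
  using assms by (intro pauli_clifford_gens rho_mask_less_pred rho_clifford_conditions) auto

section \<open>Splitting along the top bit\<close>

lemma xor_two_power: "q < 2 ^ a \<Longrightarrow> xor q (2 ^ a) = q + (2 ^ a :: nat)"
proof -
  assume q: "q < 2 ^ a"
  have "take_bit a (2 ^ a :: nat) = 0" "drop_bit a (2 ^ a :: nat) = 1"
    by (simp_all add: take_bit_eq_mod drop_bit_eq_div)
  moreover have "take_bit a (q + 2 ^ a) = q" "drop_bit a (q + 2 ^ a) = 1"
    using q by (simp_all add: take_bit_eq_mod drop_bit_eq_div)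
  ultimately show ?thesis
    using q by (subst nat_eq_take_drop_bit[of _ _ a])
      (simp add: take_bit_nat_eq_self drop_bit_nat_eq_0)
qed

lemma less_two_power_Suc_cases:
  fixes p :: nat
  assumes "p < 2 ^ Suc a"
  obtains "p < 2 ^ a" | p' where "p' < 2 ^ a" "p = xor p' (2 ^ a)" "p = p' + 2 ^ a"
proof (cases "p < 2 ^ a")
  case False
  then have "p = (p - 2 ^ a) + 2 ^ a" "p - 2 ^ a < 2 ^ a" using assms by auto
  then show thesis using xor_two_power that by metis
qed (use that in blast)

text \<open>A mask below bit \<open>a\<close> preserves that bit, so the matrix is block diagonal;
  the second block sees the phase with the bit set. This is how two representations of opposite sign
  merge into one formula.\<close>

lemma diag_block_mat_pauli:
  assumes "\<mu> < 2 ^ a"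
  shows "diag_block_mat [pauli a \<mu> \<phi>, pauli a \<mu> (\<lambda>q. \<phi> (xor q (2 ^ a)))] = pauli (Suc a) \<mu> \<phi>"
    (is "?L = ?R")
proof -
  have L: "?L = four_block_mat (pauli a \<mu> \<phi>) (0\<^sub>m (2 ^ a) (2 ^ a)) (0\<^sub>m (2 ^ a) (2 ^ a))
      (pauli a \<mu> (\<lambda>q. \<phi> (xor q (2 ^ a))))"
    by (rule diag_block_mat_two) simp_all
  show ?thesis unfolding L
  proof (rule eq_matI, goal_cases)
    case (1 p q)
    then have p: "p < 2 ^ Suc a" and q: "q < 2 ^ Suc a" by simp_all
    have swap: "xor (xor r (2 ^ a)) \<mu> = xor (xor r \<mu>) (2 ^ a)" for r by (simp add: ac_simps)
    have inj: "xor r (2 ^ a) = xor s (2 ^ a) \<longleftrightarrow> r = s" for r s :: nat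
      by (metis xor_xor_cancel)
    note less = xor_less_two_power[OF _ assms]
    from p show ?case
    proof (cases rule: less_two_power_Suc_cases)
      case p: 1
      from q show ?thesis
      proof (cases rule: less_two_power_Suc_cases)
        case 1
        then show ?thesis using p by (simp add: pauli_def)
      next
        case (2 q')
        have "xor q \<mu> = xor q' \<mu> + 2 ^ a"
          unfolding 2(2) swap by (rule xor_two_power[OF less[OF 2(1)]])
        then show ?thesis using p 2(1,3) by (simp add: pauli_def)
      qed
    next
      case p: (2 p')
      from q show ?thesis
      proof (cases rule: less_two_power_Suc_cases)
        case 1
        then show ?thesis using p(1,3) less[of q] by (simp add: pauli_def)
      next
        case (2 q')
        have "p = xor q \<mu> \<longleftrightarrow> p' = xor q' \<mu>" unfolding p(2) 2(2) swap inj ..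
        then show ?thesis using p(1,3) 2(1,3) 2(2)[symmetric] by (simp add: pauli_def)
      qed
    qed
  qed simp_all
qed

lemma diag_block_mat_gate:
  assumes "x \<in> carrier_mat a a" "y \<in> carrier_mat b b"
  shows "diag_block_mat [gate a x, gate b y] = gate (a + b) (diag_block_mat [x, y])"
  using assms unfolding diag_block_mat_two[OF assms]
  by (subst diag_block_mat_two[of _ a _ b]) (auto simp: gate_def intro!: eq_matI)

section \<open>The intertwiner\<close>

text \<open>The factor of an entry of the intertwiner contributed by one pair of tensor factors: \<open>a\<close>, \<open>b\<close>
  are the bits of the pair, \<open>t\<close> its bit of the multiplicity index, and \<open>v\<close>, \<open>u\<close> are the current and
  the preceding bit of the index of the irreducible representation. The parity of the pair is
  changed exactly by the even generators on either side of it, which flip \<open>v\<close> and \<open>u\<close>; this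
  forces the support. The phases solve the two functional equations that follow.\<close>

definition pair_coeff :: "bool \<Rightarrow> bool \<Rightarrow> bool \<Rightarrow> bool \<Rightarrow> bool \<Rightarrow> complex" where
  "pair_coeff t a b v u = (if t = (a \<noteq> (b \<noteq> (v \<noteq> u)))
    then (if a then - \<i> else 1) * (if v then \<i> else 1) * sg (a \<and> u) * sg (b \<and> v) else 0)"

text \<open>The intertwining equation for an odd generator, which acts on both bits of a single
  pair.\<close>

lemma pair_coeff_flip_pair:
  "pair_coeff t (\<not> a) (\<not> b) v u * sg a = - \<i> * sg v * sg u * pair_coeff t a b v u"
  by (cases a; cases b; cases v; cases u; simp add: pair_coeff_def)

text \<open>The intertwining equation for an even generator, which acts on the second bit of one
  pair and the first bit of the next. The bit \<open>v\<close> flipped on the other side is the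
  current bit of the first pair and the preceding bit of the second.\<close>

lemma pair_coeff_flip_link:
  "pair_coeff t a (\<not> b) v u * pair_coeff t' (\<not> a') b' v' v * sg b =
    - sg v * (pair_coeff t a b (\<not> v) u * pair_coeff t' a' b' v' (\<not> v))"
  by (cases a; cases b; cases v; cases u; cases a'; cases b'; cases v'; simp add: pair_coeff_def)

text \<open>Both factors share the preceding bit \<open>u\<close>, as happens at the first position
  where the irreducible indices of two rows differ.\<close>

lemma pair_coeff_orthogonal:
  assumes "t \<noteq> t' \<or> v \<noteq> v'"
  shows "(\<Sum>a\<in>UNIV. \<Sum>b\<in>UNIV. pair_coeff t a b v u * cnj (pair_coeff t' a b v' u)) = 0"
  using assms
  by (cases t; cases t'; cases v; cases v'; cases u; simp add: UNIV_bool pair_coeff_def)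

lemma pair_coeff_norm:
  "(\<Sum>a\<in>UNIV. \<Sum>b\<in>UNIV. pair_coeff t a b v u * cnj (pair_coeff t a b v u)) = 2"
  by (cases t; cases v; cases u; simp add: UNIV_bool pair_coeff_def)

text \<open>For odd \<open>n\<close> the last pair has one bit only: its second bit and its current
  bit \<open>v\<close> both lie beyond the index and read as \<open>False\<close>.\<close>

lemma pair_coeff_half:
  "(\<Sum>a\<in>UNIV. pair_coeff t a False False u * cnj (pair_coeff t' a False False u)) =
    (if t = t' then 1 else 0)"
  by (cases t; cases t'; cases u; simp add: UNIV_bool pair_coeff_def)

text \<open>Factor \<open>j\<close> is tied to its predecessor only through
  \<open>v (j - 1)\<close>. At \<open>j = 0\<close> that bit counts as \<open>False\<close>, in
  agreement with \<open>rho_phase\<close>.\<close>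

definition chain_coeff ::
    "nat \<Rightarrow> (nat \<Rightarrow> bool) \<Rightarrow> (nat \<Rightarrow> bool) \<Rightarrow> (nat \<Rightarrow> bool) \<Rightarrow> (nat \<Rightarrow> bool) \<Rightarrow> complex" where
  "chain_coeff m t a b v =
    (\<Prod>j<m. pair_coeff (t j) (a j) (b j) (v j) (j \<noteq> 0 \<and> v (j - 1)))"

lemma chain_coeff_flip_pair:
  assumes "l < m"
    and "\<And>j. a' j \<longleftrightarrow> (a j \<noteq> (j = l))" "\<And>j. b' j \<longleftrightarrow> (b j \<noteq> (j = l))"
  shows "chain_coeff m t a' b' v * sg (a l) =
    - \<i> * sg (v l) * sg (l \<noteq> 0 \<and> v (l - 1)) * chain_coeff m t a b v"
proof -
  let ?u = "\<lambda>j. j \<noteq> 0 \<and> v (j - 1)"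
  have split: "chain_coeff m t a b v = pair_coeff (t l) (a l) (b l) (v l) (?u l) *
      (\<Prod>j\<in>{..<m} - {l}. pair_coeff (t j) (a j) (b j) (v j) (?u j))" for a b
    unfolding chain_coeff_def using assms(1) by (subst prod.remove[of _ l]) auto
  have rest: "(\<Prod>j\<in>{..<m} - {l}. pair_coeff (t j) (a' j) (b' j) (v j) (?u j)) =
      (\<Prod>j\<in>{..<m} - {l}. pair_coeff (t j) (a j) (b j) (v j) (?u j))" (is "_ = ?Q")
    by (rule prod.cong) (auto simp: assms(2,3))
  have "chain_coeff m t a' b' v * sg (a l) =
      pair_coeff (t l) (\<not> a l) (\<not> b l) (v l) (?u l) * sg (a l) * ?Q"
    unfolding split[of a'] rest by (simp add: assms(2,3))
  also have "\<dots> = - \<i> * sg (v l) * sg (?u l) * chain_coeff m t a b v"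
    unfolding pair_coeff_flip_pair split[of a] by (simp add: mult.assoc)
  finally show ?thesis .
qed

text \<open>The bit \<open>v l\<close> enters factor \<open>l\<close> as its current bit and factor
  \<open>Suc l\<close> as its preceding bit. All other factors are untouched, so the two-factor
  equation suffices.\<close>

lemma chain_coeff_flip_link:
  assumes "Suc l < m"
    and "\<And>j. a' j \<longleftrightarrow> (a j \<noteq> (j = Suc l))" "\<And>j. b' j \<longleftrightarrow> (b j \<noteq> (j = l))"
    and "\<And>j. v' j \<longleftrightarrow> (v j \<noteq> (j = l))"
  shows "chain_coeff m t a' b' v * sg (b l) = - sg (v l) * chain_coeff m t a b v'"
proof -
  let ?f = "\<lambda>a b v j. pair_coeff (t j) (a j) (b j) (v j) (j \<noteq> 0 \<and> v (j - 1))"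
  have split: "chain_coeff m t a b v = ?f a b v l * ?f a b v (Suc l) *
      (\<Prod>j\<in>{..<m} - {l} - {Suc l}. ?f a b v j)" for a b v
    unfolding chain_coeff_def using assms(1)
    by (subst prod.remove[of _ l], simp, simp, subst prod.remove[of _ "Suc l"]) (auto simp: mult.assoc)
  have rest: "(\<Prod>j\<in>{..<m} - {l} - {Suc l}. ?f a' b' v j) =
      (\<Prod>j\<in>{..<m} - {l} - {Suc l}. ?f a b v' j)" (is "_ = ?Q")
  proof (rule prod.cong)
    fix j assume "j \<in> {..<m} - {l} - {Suc l}"
    then have "j \<noteq> l" "j \<noteq> Suc l" by auto
    moreover from this have "j - 1 \<noteq> l \<or> j = 0" by auto
    ultimately show "?f a' b' v j = ?f a b v' j" by (auto simp: assms(2-4))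
  qed simp
  have "chain_coeff m t a' b' v * sg (b l) =
      pair_coeff (t l) (a l) (\<not> b l) (v l) (l \<noteq> 0 \<and> v (l - 1)) *
      pair_coeff (t (Suc l)) (\<not> a (Suc l)) (b (Suc l)) (v (Suc l)) (v l) * sg (b l) * ?Q"
    unfolding split[of a'] rest by (simp add: assms(2,3))
  also have "\<dots> = - sg (v l) * (pair_coeff (t l) (a l) (b l) (\<not> v l) (l \<noteq> 0 \<and> v (l - 1)) *
      pair_coeff (t (Suc l)) (a (Suc l)) (b (Suc l)) (v (Suc l)) (\<not> v l)) * ?Q"
    unfolding pair_coeff_flip_link ..
  also have "\<dots> = - sg (v l) * chain_coeff m t a b v'"
  proof -
    have "v' (l - 1) = v (l - 1)" if "l \<noteq> 0" using that by (auto simp: assms(4))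
    then have "(l \<noteq> 0 \<and> v' (l - 1)) = (l \<noteq> 0 \<and> v (l - 1))" by auto
    then show ?thesis unfolding split[of a] by (simp add: assms(4) mult.assoc)
  qed
  finally show ?thesis .
qed

text \<open>A row index consists of a multiplicity index in its low \<open>n - n div 2\<close> bits and of a basis
  index of the irreducible representation in its high bits; the bits of a column index are
  grouped into consecutive pairs.\<close>

definition intertwiner_coeff :: "nat \<Rightarrow> nat \<Rightarrow> nat \<Rightarrow> complex" where
  "intertwiner_coeff n p w = (let m = n - n div 2 in
    chain_coeff m (bit p) (\<lambda>j. bit w (2 * j)) (\<lambda>j. bit w (2 * j + 1)) (\<lambda>j. bit p (m + j)))"

definition intertwiner :: "nat \<Rightarrow> complex mat" where
  "intertwiner n = mat (2 ^ n) (2 ^ n) (\<lambda>(p, w). intertwiner_coeff n p w)"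

lemma intertwiner_carrier [simp]: "intertwiner n \<in> carrier_mat (2 ^ n) (2 ^ n)"
  by (simp add: intertwiner_def)

lemma chain_coeff_cong:
  assumes "\<And>j. j < m \<Longrightarrow> t j = t' j" "\<And>j. j < m \<Longrightarrow> a j = a' j" "\<And>j. j < m \<Longrightarrow> b j = b' j"
    "\<And>j. j < m \<Longrightarrow> v j = v' j"
  shows "chain_coeff m t a b v = chain_coeff m t' a' b' v'"
  unfolding chain_coeff_def
proof (rule prod.cong)
  fix j assume "j \<in> {..<m}"
  then show "pair_coeff (t j) (a j) (b j) (v j) (j \<noteq> 0 \<and> v (j - 1)) =
      pair_coeff (t' j) (a' j) (b' j) (v' j) (j \<noteq> 0 \<and> v' (j - 1))"
    using assms[of j] assms(4)[of "j - 1"] by auto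
qed simp

text \<open>Generator \<open>2 * l + 1\<close> flips the two bits of pair \<open>l\<close>, while
  \<open>2 * Suc l\<close> flips the second bit of pair \<open>l\<close> and the first bit of pair
  \<open>Suc l\<close>; these are the two flip equations of the chain.\<close>

lemma intertwiner_coeff_intertwines:
  fixes n :: nat
  assumes i: "i \<in> {1..<n}"
  defines "m \<equiv> n - n div 2"
  shows "intertwiner_coeff n p (xor w (pi_mask i)) * pi_phase i w =
    rho_phase i (drop_bit m (xor p (push_bit m (rho_mask i)))) *
    intertwiner_coeff n (xor p (push_bit m (rho_mask i))) w"
proof -
  have "1 \<le> i" using i by simp
  have "\<exists>l. i = 2 * l + 1 \<or> i = 2 * Suc l"
    using \<open>1 \<le> i\<close> by presburger
  then consider (pair) l where "i = 2 * l + 1" | (link) l where "i = 2 * Suc l" by blast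
  then show ?thesis
  proof cases
    case (pair l)
    then have l: "l < m" "i div 2 = l" using i by (auto simp: m_def)
    have "chain_coeff m (bit p) (\<lambda>j. bit (xor w (pi_mask i)) (2 * j))
        (\<lambda>j. bit (xor w (pi_mask i)) (2 * j + 1)) (\<lambda>j. bit p (m + j)) * sg (bit w (2 * l)) =
      - \<i> * sg (bit p (m + l)) * sg (l \<noteq> 0 \<and> bit p (m + (l - 1))) *
      chain_coeff m (bit p) (\<lambda>j. bit w (2 * j)) (\<lambda>j. bit w (2 * j + 1)) (\<lambda>j. bit p (m + j))"
      by (rule chain_coeff_flip_pair[OF l(1)])
        (use \<open>1 \<le> i\<close> pair in \<open>auto simp: bit_xor_iff bit_pi_mask\<close>)
    then show ?thesis
      using pair l by (simp add: intertwiner_coeff_def Let_def m_def[symmetric] rho_mask_def pi_phase_def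
          rho_phase_def bit_drop_bit_eq)
  next
    case (link l)
    then have l: "Suc l < m" using i by (auto simp: m_def)
    define p' where "p' = xor p (push_bit m (rho_mask i))"
    have p': "bit p' (m + j) \<longleftrightarrow> (bit p (m + j) \<noteq> (j = l))" for j
      using link by (auto simp: p'_def rho_mask_def bit_xor_iff bit_push_bit_iff bit_exp_iff)
    \<comment> \<open>The multiplicity index is not moved, reflecting the trivial action on the
      first tensor factor.\<close>
    have low: "bit p' j = bit p j" if "j < m" for j
      using that by (simp add: p'_def bit_xor_iff bit_push_bit_iff)
    have "chain_coeff m (bit p) (\<lambda>j. bit (xor w (pi_mask i)) (2 * j))
        (\<lambda>j. bit (xor w (pi_mask i)) (2 * j + 1)) (\<lambda>j. bit p (m + j)) * sg (bit w (2 * l + 1)) =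
      - sg (bit p (m + l)) *
      chain_coeff m (bit p) (\<lambda>j. bit w (2 * j)) (\<lambda>j. bit w (2 * j + 1)) (\<lambda>j. bit p' (m + j))"
      by (rule chain_coeff_flip_link[OF l _ _ p'])
        (use \<open>1 \<le> i\<close> link in \<open>auto simp: bit_xor_iff bit_pi_mask\<close>)
    also have "chain_coeff m (bit p) (\<lambda>j. bit w (2 * j)) (\<lambda>j. bit w (2 * j + 1)) (\<lambda>j. bit p' (m + j)) =
      chain_coeff m (bit p') (\<lambda>j. bit w (2 * j)) (\<lambda>j. bit w (2 * j + 1)) (\<lambda>j. bit p' (m + j))"
      by (rule chain_coeff_cong) (simp_all add: low)
    finally show ?thesis
      unfolding p'_def[symmetric] using link p'[of l]
      by (simp add: intertwiner_coeff_def Let_def m_def[symmetric] pi_phase_def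
          rho_phase_def bit_drop_bit_eq)
  qed
qed

text \<open>The monomial matrix on the right is the identity on the low \<open>n - n div 2\<close>
  bits tensored with the irreducible-side generator on the others.\<close>

lemma intertwiner_pauli:
  assumes i: "i \<in> {1..<n}"
  shows "intertwiner n * pauli n (pi_mask i) (pi_phase i) =
    pauli n (push_bit (n - n div 2) (rho_mask i)) (\<lambda>q. rho_phase i (drop_bit (n - n div 2) q)) * intertwiner n"
    (is "_ = pauli n ?M ?\<phi> * _")
proof (rule eq_matI)
  have "rho_mask i < 2 ^ (n div 2)" using i by (intro rho_mask_less) auto
  then have "?M < 2 ^ (n div 2) * 2 ^ (n - n div 2)" by (simp add: push_bit_eq_mult)
  also have "\<dots> = 2 ^ n" by (simp flip: power_add)
  finally have M: "?M < 2 ^ n" .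
  fix p w assume "p < dim_row (pauli n ?M ?\<phi> * intertwiner n)" "w < dim_col (pauli n ?M ?\<phi> * intertwiner n)"
  then have pw: "p < 2 ^ n" "w < 2 ^ n" by (simp_all add: intertwiner_def)
  show "(intertwiner n * pauli n (pi_mask i) (pi_phase i)) $$ (p, w) =
      (pauli n ?M ?\<phi> * intertwiner n) $$ (p, w)"
    unfolding times_pauli_index[OF intertwiner_carrier pw pi_mask_less[OF i]]
      pauli_times_index[OF intertwiner_carrier pw M]
    using pw xor_less_two_power[OF pw(1) M] xor_less_two_power[OF pw(2) pi_mask_less[OF i]]
      intertwiner_coeff_intertwines[OF i, of p w]
    by (simp add: intertwiner_def)
qed (simp_all add: intertwiner_def)

section \<open>Factoring sums over bit strings\<close>

lemma bit_add_two_power: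
  fixes w :: nat
  assumes "w < 2 ^ N"
  shows "bit (w + 2 ^ N) j \<longleftrightarrow> bit w j \<or> j = N"
proof -
  have "\<not> bit w N" using assms by (rule not_bit_high) simp
  then show ?thesis
    unfolding xor_two_power[OF assms, symmetric] by (auto simp: bit_xor_iff bit_exp_iff)
qed

lemma sum_less_two_power_Suc:
  "(\<Sum>w<(2 :: nat) ^ Suc N. h w) = (\<Sum>w<(2 :: nat) ^ N. h w + h (w + 2 ^ N :: nat))" for h :: "nat \<Rightarrow> complex"
proof -
  have "(\<Sum>w<(2 :: nat) ^ Suc N. h w) = sum h {0..<2 ^ N} + sum h {0 + 2 ^ N..<2 ^ N + 2 ^ N}"
    by (simp add: sum.atLeastLessThan_concat mult_2 lessThan_atLeast0)
  then show ?thesis unfolding sum.shift_bounds_nat_ivl by (simp add: sum.distrib lessThan_atLeast0)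
qed

text \<open>The bits of \<open>w\<close> range independently, so this is the distributive law; the
  induction peels off the two highest bits.\<close>

lemma sum_prod_bit_pairs:
  fixes f :: "nat \<Rightarrow> bool \<Rightarrow> bool \<Rightarrow> complex"
  shows "(\<Sum>w<(2 :: nat) ^ (2 * m). \<Prod>j<m. f j (bit w (2 * j)) (bit w (2 * j + 1))) =
    (\<Prod>j<m. \<Sum>a\<in>UNIV. \<Sum>b\<in>UNIV. f j a b)"
proof (induction m)
  case (Suc m)
  let ?g = "\<lambda>w. \<Prod>j<m. f j (bit w (2 * j)) (bit w (2 * j + 1))"
  have low: "?g (w + 2 ^ N) = ?g w" if "w < 2 ^ N" "2 * m \<le> N" for w N :: nat
    using that by (intro prod.cong) (auto simp: bit_add_two_power)
  have "(\<Sum>w<(2 :: nat) ^ (2 * Suc m). \<Prod>j<Suc m. f j (bit w (2 * j)) (bit w (2 * j + 1))) =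
      (\<Sum>w<(2 :: nat) ^ Suc (Suc (2 * m)). ?g w * f m (bit w (2 * m)) (bit w (Suc (2 * m))))"
    by simp
  also have "\<dots> = (\<Sum>w<(2 :: nat) ^ Suc (2 * m). ?g w * (f m (bit w (2 * m)) False + f m (bit w (2 * m)) True))"
    unfolding sum_less_two_power_Suc[of _ "Suc (2 * m)"]
  proof (rule sum.cong[OF refl])
    fix w :: nat assume "w \<in> {..<2 ^ Suc (2 * m)}"
    then have w: "w < 2 ^ Suc (2 * m)" by simp
    show "?g w * f m (bit w (2 * m)) (bit w (Suc (2 * m))) +
        ?g (w + 2 ^ Suc (2 * m)) * f m (bit (w + 2 ^ Suc (2 * m)) (2 * m))
          (bit (w + 2 ^ Suc (2 * m)) (Suc (2 * m))) =
        ?g w * (f m (bit w (2 * m)) False + f m (bit w (2 * m)) True)"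
      unfolding low[OF w le_SucI[OF order_refl]] bit_add_two_power[OF w]
      using not_bit_high[OF w order_refl] by (simp add: distrib_left)
  qed
  also have "\<dots> = (\<Sum>w<(2 :: nat) ^ (2 * m). ?g w * (\<Sum>a\<in>UNIV. \<Sum>b\<in>UNIV. f m a b))"
    unfolding sum_less_two_power_Suc
  proof (rule sum.cong[OF refl])
    fix w :: nat assume "w \<in> {..<2 ^ (2 * m)}"
    then have w: "w < 2 ^ (2 * m)" by simp
    show "?g w * (f m (bit w (2 * m)) False + f m (bit w (2 * m)) True) +
        ?g (w + 2 ^ (2 * m)) * (f m (bit (w + 2 ^ (2 * m)) (2 * m)) False +
          f m (bit (w + 2 ^ (2 * m)) (2 * m)) True) = ?g w * (\<Sum>a\<in>UNIV. \<Sum>b\<in>UNIV. f m a b)"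
      unfolding low[OF w order_refl] bit_add_two_power[OF w]
      using not_bit_high[OF w order_refl] by (simp add: UNIV_bool distrib_left)
  qed
  also have "\<dots> = (\<Prod>j<Suc m. \<Sum>a\<in>UNIV. \<Sum>b\<in>UNIV. f j a b)"
    unfolding sum_distrib_right[symmetric] Suc.IH by simp
  finally show ?case .
qed simp

text \<open>The last pair contributes only its low bit; bit \<open>2 * m + 1\<close> lies beyond
  \<open>w\<close> and reads as \<open>False\<close>.\<close>

lemma sum_prod_bit_pairs_odd:
  fixes f :: "nat \<Rightarrow> bool \<Rightarrow> bool \<Rightarrow> complex"
  shows "(\<Sum>w<(2 :: nat) ^ (2 * m + 1). \<Prod>j<Suc m. f j (bit w (2 * j)) (bit w (2 * j + 1))) =
    (\<Prod>j<m. \<Sum>a\<in>UNIV. \<Sum>b\<in>UNIV. f j a b) * (\<Sum>a\<in>UNIV. f m a False)"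
proof -
  let ?g = "\<lambda>w. \<Prod>j<m. f j (bit w (2 * j)) (bit w (2 * j + 1))"
  have "(\<Sum>w<(2 :: nat) ^ (2 * m + 1). \<Prod>j<Suc m. f j (bit w (2 * j)) (bit w (2 * j + 1))) =
      (\<Sum>w<(2 :: nat) ^ Suc (2 * m). ?g w * f m (bit w (2 * m)) (bit w (Suc (2 * m))))"
    by simp
  also have "\<dots> = (\<Sum>w<(2 :: nat) ^ (2 * m). ?g w * (\<Sum>a\<in>UNIV. f m a False))"
    unfolding sum_less_two_power_Suc
  proof (rule sum.cong[OF refl])
    fix w :: nat assume "w \<in> {..<2 ^ (2 * m)}"
    then have w: "w < 2 ^ (2 * m)" by simp
    have low: "?g (w + 2 ^ (2 * m)) = ?g w"
      using w by (intro prod.cong) (auto simp: bit_add_two_power)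
    show "?g w * f m (bit w (2 * m)) (bit w (Suc (2 * m))) +
        ?g (w + 2 ^ (2 * m)) * f m (bit (w + 2 ^ (2 * m)) (2 * m)) (bit (w + 2 ^ (2 * m)) (Suc (2 * m))) =
        ?g w * (\<Sum>a\<in>UNIV. f m a False)"
      unfolding low bit_add_two_power[OF w]
      using not_bit_high[OF w order_refl] not_bit_high[OF w le_SucI[OF order_refl]]
      by (simp add: UNIV_bool distrib_left)
  qed
  finally show ?thesis unfolding sum_distrib_right[symmetric] sum_prod_bit_pairs .
qed

text \<open>Locates a pair at which the Gram factor of two distinct rows vanishes: any place where
  \<open>t\<close> differs if \<open>v = v'\<close>, and otherwise the first place where
  \<open>v\<close> differs. In either case the preceding bits agree.\<close>

lemma chain_gram_zero:
  fixes t t' v v' :: "nat \<Rightarrow> bool"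
  assumes "t \<noteq> t' \<or> v \<noteq> v'"
    and "\<And>j. k \<le> j \<Longrightarrow> \<not> v j \<and> \<not> v' j"
  shows "\<exists>j. (t j \<noteq> t' j \<or> v j \<noteq> v' j) \<and> (j \<noteq> 0 \<and> v (j - 1)) = (j \<noteq> 0 \<and> v' (j - 1)) \<and>
    (v j \<noteq> v' j \<longrightarrow> j < k)"
proof (cases "v = v'")
  case True
  then obtain j where "t j \<noteq> t' j" using assms(1) by blast
  then show ?thesis using True by (intro exI[of _ j]) simp
next
  case False
  define j where "j = (LEAST j. v j \<noteq> v' j)"
  obtain i where "v i \<noteq> v' i" using False by blast
  then have j: "v j \<noteq> v' j" unfolding j_def by (rule LeastI[of "\<lambda>j. v j \<noteq> v' j"])
  moreover have "v (j - 1) = v' (j - 1)" if "j \<noteq> 0"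
    using not_less_Least[of "j - 1" "\<lambda>j. v j \<noteq> v' j"] that unfolding j_def[symmetric] by simp
  moreover have "j < k" using j assms(2)[of j] by (metis not_le)
  ultimately show ?thesis by (intro exI[of _ j]) (cases "j = 0"; simp)
qed

section \<open>The decomposition\<close>

text \<open>The sum factors into one term \<open>S j\<close> for each full pair and, for odd
  \<open>n\<close>, a term \<open>H\<close> for the half pair. For equal rows these are 2 and 1; for
  distinct rows one of them is zero.\<close>

lemma intertwiner_gram:
  assumes p: "p < 2 ^ n" and p': "p' < 2 ^ n"
  shows "(\<Sum>w<(2 :: nat) ^ n. intertwiner_coeff n p w * cnj (intertwiner_coeff n p' w)) =
    (if p = p' then 2 ^ (n div 2) else 0)"
proof -
  define k m where "k = n div 2" and "m = n - n div 2"
  define v where "v p j = bit p (m + j)" for p j :: nat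
  \<comment> \<open>Cut off at \<open>m\<close>, since the bits of \<open>p\<close> from
    \<open>m\<close> on belong to \<open>v\<close>.\<close>
  define t where "t p j = (j < m \<and> bit p j)" for p j :: nat
  define u where "u p j = (j \<noteq> 0 \<and> v p (j - 1))" for p j
  define f where "f j a b = pair_coeff (bit p j) a b (v p j) (u p j) *
    cnj (pair_coeff (bit p' j) a b (v p' j) (u p' j))" for j a b
  define S where "S j = (\<Sum>a\<in>UNIV. \<Sum>b\<in>UNIV. f j a b)" for j
  define H where "H = (if even n then 1 else \<Sum>a\<in>UNIV. f k a False)"
  have "(\<Sum>w<(2 :: nat) ^ n. intertwiner_coeff n p w * cnj (intertwiner_coeff n p' w)) =
      (\<Sum>w<(2 :: nat) ^ n. \<Prod>j<m. f j (bit w (2 * j)) (bit w (2 * j + 1)))"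
    by (simp add: intertwiner_coeff_def Let_def chain_coeff_def prod.distrib f_def u_def v_def
        m_def[symmetric])
  also have "\<dots> = (\<Prod>j<k. S j) * H"
  proof (cases "even n")
    case True
    then have "m = k" "n = 2 * k" by (auto simp: m_def k_def)
    then show ?thesis using sum_prod_bit_pairs[where m = k and f = f] True by (simp add: S_def H_def)
  next
    case False
    then have "m = Suc k" "n = 2 * k + 1" by (auto simp: m_def k_def elim!: oddE)
    then show ?thesis using sum_prod_bit_pairs_odd[where m = k and f = f] False by (simp add: S_def H_def)
  qed
  also have "\<dots> = (if p = p' then 2 ^ k else 0)"
  proof (cases "p = p'")
    case True
    \<comment> \<open>For odd \<open>n\<close>, the half pair takes bit \<open>m + k = n\<close> of
      \<open>p\<close> as its current bit, which is beyond the index.\<close>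
    have "\<not> v p k" if "odd n" using not_bit_high[OF p, of "m + k"] by (simp add: v_def m_def k_def)
    then have "H = 1" using True by (simp add: H_def f_def pair_coeff_half)
    moreover have "S j = 2" for j using True by (simp add: S_def f_def pair_coeff_norm)
    ultimately show ?thesis using True by simp
  next
    case False
    have high: "\<not> v p j \<and> \<not> v p' j" if "k \<le> j" for j
      using that not_bit_high[OF p, of "m + j"] not_bit_high[OF p', of "m + j"]
      by (simp add: v_def m_def k_def)
    have "t p \<noteq> t p' \<or> v p \<noteq> v p'"
    proof (rule ccontr)
      assume "\<not> ?thesis"
      then have eq: "t p j = t p' j" "v p j = v p' j" for j by simp_all
      have "bit p j = bit p' j" for j
        using eq(1)[of j] eq(2)[of "j - m"] by (cases "j < m") (simp_all add: t_def v_def)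
      then show False using False by (simp add: bit_eq_iff)
    qed
    from chain_gram_zero[of "t p" "t p'" "v p" "v p'" k, OF this high] obtain j where
      j: "t p j \<noteq> t p' j \<or> v p j \<noteq> v p' j" "u p j = u p' j" "v p j \<noteq> v p' j \<Longrightarrow> j < k"
      unfolding u_def by blast
    have ne: "bit p j \<noteq> bit p' j \<or> v p j \<noteq> v p' j" using j(1) by (auto simp: t_def)
    have "(\<Prod>j<k. S j) * H = 0"
    proof (cases "j < k")
      case True
      have "S j = 0" unfolding S_def f_def j(2) by (rule pair_coeff_orthogonal[OF ne])
      then show ?thesis using True by (auto intro: prod_zero)
    next
      case ge: False
      then have "v p j = v p' j" using j(3) by blast
      then have tj: "bit p j \<noteq> bit p' j" "j < m" using j(1) by (auto simp: t_def)
      \<comment> \<open>A position from \<open>k\<close> on but below \<open>m\<close> exists only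
        for odd \<open>n\<close>, where it is the half pair.\<close>
      then have "odd n" "j = k" using ge by (auto simp: m_def k_def)
      then have "H = 0" using tj(1) high[of k] j(2) by (simp add: H_def f_def pair_coeff_half)
      then show ?thesis by simp
    qed
    then show ?thesis using False by simp
  qed
  finally show ?thesis by (simp add: k_def)
qed

lemma intertwiner_in_GL: "intertwiner n \<in> carrier (GL (2 ^ n))"
proof -
  \<comment> \<open>The conjugate transpose, scaled by the Gram constant, is a right inverse; for
    square matrices it is then two-sided.\<close>
  define B where "B = (1 / 2 ^ (n div 2)) \<cdot>\<^sub>m
    mat (2 ^ n) (2 ^ n) (\<lambda>(w, p). cnj (intertwiner_coeff n p w))"
  have B: "B \<in> carrier_mat (2 ^ n) (2 ^ n)" by (simp add: B_def)
  have "intertwiner n * B = 1\<^sub>m (2 ^ n)"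
  proof (rule eq_matI)
    fix p p' assume "p < dim_row (1\<^sub>m (2 ^ n) :: complex mat)" "p' < dim_col (1\<^sub>m (2 ^ n) :: complex mat)"
    then have p: "p < 2 ^ n" "p' < 2 ^ n" by simp_all
    then have "(intertwiner n * B) $$ (p, p') =
        (\<Sum>w<(2 :: nat) ^ n. intertwiner_coeff n p w * cnj (intertwiner_coeff n p' w)) / 2 ^ (n div 2)"
      by (simp add: intertwiner_def B_def scalar_prod_def lessThan_atLeast0 sum_divide_distrib)
    then show "(intertwiner n * B) $$ (p, p') = 1\<^sub>m (2 ^ n) $$ (p, p')"
      using p by (simp add: intertwiner_gram)
  qed (simp_all add: B_def intertwiner_def)
  moreover from this have "B * intertwiner n = 1\<^sub>m (2 ^ n)"
    by (intro mat_mult_left_right_inverse[OF intertwiner_carrier B])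
  ultimately show ?thesis using B unfolding GL_carrier_iff by auto
qed

lemma gate_intertwine:
  assumes "P \<in> carrier_mat N N" "x \<in> carrier_mat N N" "y \<in> carrier_mat N N" "P * x = y * P"
  shows "P * gate N x = gate N y * P"
  using assms by (simp add: gate_def mult_smult_assoc_mat[where nr = N and n = N and nc = N]
      mult_smult_distrib[where nr = N and n = N and nc = N]
      add_mult_distrib_mat[where nr = N and n = N and nc = N]
      mult_add_distrib_mat[where nr = N and n = N and nc = N])

text \<open>Handles both parities at once, using only that \<open>\<rho>\<close> acts on the
  generators by the formulas for \<open>V1_rep\<close> on \<open>n div 2\<close> bits.\<close>

lemma isomorphic_tensor_trivial:
  fixes n :: nat
  defines "k \<equiv> n div 2" and "m \<equiv> n - n div 2"
  assumes \<rho>: "representation (braid_group n) (2 ^ k) \<rho>"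
    and gen: "\<And>i. i \<in> {1..<n} \<Longrightarrow> \<rho> (pres_gen {1..<n} (braid_relations n) i) =
      gate (2 ^ k) (pauli k (rho_mask i) (rho_phase i))"
  shows "isomorphic_reps (braid_group n) (2 ^ n) (pi_rep n) (tensor_rep (trivial_rep (2 ^ m)) \<rho>)"
proof (rule isomorphic_repsI)
  have mk: "2 ^ m * 2 ^ k = (2 :: nat) ^ n" "m + k = n"
    by (simp_all add: m_def k_def flip: power_add)
  show "representation (braid_group n) (2 ^ n) (pi_rep n)"
    unfolding pi_rep_def by (rule clifford_braid_rep(1)[OF clifford_gens_pi pi_gen_eq])
  show "representation (braid_group n) (2 ^ n) (tensor_rep (trivial_rep (2 ^ m)) \<rho>)"
    using representation_tensor_trivial[OF \<rho>, of "2 ^ m"] by (simp only: mk)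
  show "intertwiner n \<in> carrier (GL (2 ^ n))" by (rule intertwiner_in_GL)
  fix i assume i: "i \<in> {1..<n}"
  let ?g = "pres_gen {1..<n} (braid_relations n) i"
  have "pi_rep n ?g = gate (2 ^ n) (pauli n (pi_mask i) (pi_phase i))"
    using clifford_braid_rep(2)[OF clifford_gens_pi pi_gen_eq i] pi_gen_eq[OF i]
    by (simp add: pi_rep_def)
  moreover have "tensor_rep (trivial_rep (2 ^ m)) \<rho> ?g =
      gate (2 ^ n) (pauli n (push_bit m (rho_mask i)) (\<lambda>q. rho_phase i (drop_bit m q)))"
  proof -
    have mask: "rho_mask i < 2 ^ k" unfolding k_def using i by (intro rho_mask_less) auto
    have "tensor_rep (trivial_rep (2 ^ m)) \<rho> ?g =
        I2pow m \<otimes>\<^sub>k gate (2 ^ k) (pauli k (rho_mask i) (rho_phase i)) \<otimes>\<^sub>k I2pow 0"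
      unfolding tensor_rep_def trivial_rep_def gen[OF i] by (simp add: I2pow_eq)
    also have "\<dots> = gate (2 ^ n) (pauli n (push_bit m (rho_mask i))
        (\<lambda>q. rho_phase i (take_bit k (drop_bit m q))))"
      using mask mk(2) by (intro kron_gate_pauli_embed) simp_all
    also have "\<dots> = gate (2 ^ n) (pauli n (push_bit m (rho_mask i)) (\<lambda>q. rho_phase i (drop_bit m q)))"
    proof (intro arg_cong[where f = "gate (2 ^ n)"] pauli_cong refl arg_cong[where f = "rho_phase i"])
      fix q :: nat assume "q < 2 ^ n"
      then have "q < 2 ^ m * 2 ^ k" unfolding mk .
      then have "drop_bit m q < 2 ^ k" unfolding drop_bit_eq_div by (rule div_less_of_less_mult)
      then show "take_bit k (drop_bit m q) = drop_bit m q" by (rule take_bit_nat_eq_self)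
    qed
    finally show ?thesis .
  qed
  ultimately show "intertwiner n * pi_rep n ?g = tensor_rep (trivial_rep (2 ^ m)) \<rho> ?g * intertwiner n"
    using intertwiner_pauli[OF i] by (simp add: gate_intertwine m_def)
qed

theorem theorem4p4:
  fixes n :: nat
  assumes "n \<ge> 2"
  shows "(odd n \<longrightarrow>
      isomorphic_reps (braid_group n) (2 ^ n) (pi_rep n)
        (tensor_rep (trivial_rep (2 ^ ((n + 1) div 2))) (V1_rep n))) \<and>
    (even n \<longrightarrow>
      isomorphic_reps (braid_group n) (2 ^ n) (pi_rep n)
        (tensor_rep (trivial_rep (2 ^ (n div 2))) (direct_sum_rep (W1_rep n) (W2_rep n))))"
proof (intro conjI impI)
  assume "odd n"
  define k where "k = n div 2"
  have n: "n = 2 * k + 1" using \<open>odd n\<close> by (simp add: k_def)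
  have m: "(n + 1) div 2 = n - n div 2" and k: "(n - 1) div 2 = k" using n by simp_all
  have gen: "rho_gen k i = gate (2 ^ k) (pauli k (rho_mask i) (rho_phase i))" if "i \<in> {1..<n}" for i
    using that n by (intro rho_gen_eq) auto
  have rep: "representation (braid_group n) (2 ^ k) (V1_rep n)"
    using clifford_braid_rep(1)[OF clifford_gens_rho gen] n by (simp add: V1_rep_def k)
  have "V1_rep n (pres_gen {1..<n} (braid_relations n) i) = gate (2 ^ k) (pauli k (rho_mask i) (rho_phase i))"
    if "i \<in> {1..<n}" for i
    using clifford_braid_rep(2)[OF clifford_gens_rho gen that] n gen[OF that] by (simp add: V1_rep_def k)
  with rep show "isomorphic_reps (braid_group n) (2 ^ n) (pi_rep n)
      (tensor_rep (trivial_rep (2 ^ ((n + 1) div 2))) (V1_rep n))"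
    unfolding m k_def by (rule isomorphic_tensor_trivial)
next
  assume "even n"
  define k where "k = n div 2"
  have n: "n = 2 * k" using \<open>even n\<close> by (simp add: k_def)
  have "k \<ge> 1" using n assms by simp
  then have sum: "(2 :: nat) ^ (k - 1) + 2 ^ (k - 1) = 2 ^ k" by (cases k) simp_all
  have m: "n div 2 = n - n div 2" using n by simp
  \<comment> \<open>The shift \<open>t = 0\<close> gives the first summand, and
    \<open>t = 2 ^ (k - 1)\<close>, which sets the additional top bit, gives the second.\<close>
  define x where "x t i = pauli (k - 1) (rho_mask i) (\<lambda>q. rho_phase i (xor q t))" for t i
  have gen1: "lambda_gen 1 k i = gate (2 ^ (k - 1)) (x 0 i)"
    and gen2: "lambda_gen (-1) k i = gate (2 ^ (k - 1)) (x (2 ^ (k - 1)) i)" if "i \<in> {1..<n}" for i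
    using that n lambda_x_eq[of i k 0 False] lambda_x_eq[of i k "2 ^ (k - 1)" True]
    by (simp_all add: lambda_gen_def gate_def x_def)
  have cl: "clifford_gens n (2 ^ (k - 1)) (x t)" for t
    unfolding x_def using n by (intro clifford_gens_lambda) simp
  have rep1: "representation (braid_group n) (2 ^ (k - 1)) (W1_rep n)"
    and rep2: "representation (braid_group n) (2 ^ (k - 1)) (W2_rep n)"
    using clifford_braid_rep(1)[OF cl gen1] clifford_braid_rep(1)[OF cl gen2]
    by (simp_all add: W1_rep_def W2_rep_def Let_def flip: k_def)
  have rep: "representation (braid_group n) (2 ^ k) (direct_sum_rep (W1_rep n) (W2_rep n))"
    using representation_direct_sum[OF rep1 rep2] unfolding sum .
  have gen: "direct_sum_rep (W1_rep n) (W2_rep n) (pres_gen {1..<n} (braid_relations n) i) =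
      gate (2 ^ k) (pauli k (rho_mask i) (rho_phase i))" if i: "i \<in> {1..<n}" for i
  proof -
    have "W1_rep n (pres_gen {1..<n} (braid_relations n) i) = gate (2 ^ (k - 1)) (x 0 i)"
      "W2_rep n (pres_gen {1..<n} (braid_relations n) i) = gate (2 ^ (k - 1)) (x (2 ^ (k - 1)) i)"
      using clifford_braid_rep(2)[OF cl gen1 i] clifford_braid_rep(2)[OF cl gen2 i] gen1[OF i] gen2[OF i]
      by (simp_all add: W1_rep_def W2_rep_def Let_def flip: k_def)
    then have "direct_sum_rep (W1_rep n) (W2_rep n) (pres_gen {1..<n} (braid_relations n) i) =
        diag_block_mat [gate (2 ^ (k - 1)) (x 0 i), gate (2 ^ (k - 1)) (x (2 ^ (k - 1)) i)]"
      by (simp only: direct_sum_rep_def)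
    also have "\<dots> = gate (2 ^ k) (diag_block_mat [x 0 i, x (2 ^ (k - 1)) i])"
      unfolding sum[symmetric] by (rule diag_block_mat_gate) (simp_all add: x_def)
    \<comment> \<open>The top bit selects the summand, so the direct sum is a single monomial matrix
      on \<open>k\<close> bits.\<close>
    also have "diag_block_mat [x 0 i, x (2 ^ (k - 1)) i] = pauli (Suc (k - 1)) (rho_mask i) (rho_phase i)"
      unfolding x_def xor.right_neutral
      by (rule diag_block_mat_pauli) (use i n in \<open>intro rho_mask_less_pred; simp\<close>)
    also have "Suc (k - 1) = k" using \<open>k \<ge> 1\<close> by simp
    finally show ?thesis .
  qed
  have "isomorphic_reps (braid_group n) (2 ^ n) (pi_rep n)
      (tensor_rep (trivial_rep (2 ^ (n - n div 2))) (direct_sum_rep (W1_rep n) (W2_rep n)))"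
    using rep gen unfolding k_def by (rule isomorphic_tensor_trivial)
  then show "isomorphic_reps (braid_group n) (2 ^ n) (pi_rep n)
      (tensor_rep (trivial_rep (2 ^ (n div 2))) (direct_sum_rep (W1_rep n) (W2_rep n)))"
    using m by simp
qed

end
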